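(* Let $\mathcal{M}=\{p_\theta\mu \mid \theta\in\Theta\}$ be a regular exponential family of order $d\ge 1$ with dominating measure $\mu$ and canonical sufficient statistic $T$, let $\mathcal{M}^n$ ($n\ge 1$) be its $n$-fold IID extensions, and let $\mathcal{N}_n$ ($n\ge 1$) be the corresponding natural exponential families (all as defined in the context). Suppose $g$ is a Riemannian metric on $\mathcal{M}$ and that, for every integer $n\ge 1$, $g^n$ is a Riemannian metric on $\mathcal{M}^n$ and $g_n$ is a Riemannian metric on $\mathcal{N}_n$ (here $g^n$ is a metric indexed by $n$, not a power). For $u\in T\Theta=\Theta\times\mathbb{R}^d$, let $\tilde u$, $\tilde u^n$, $\tilde u_n$ be the corresponding tangent vectors to $\mathcal{M}$, $\mathcal{M}^n$, $\mathcal{N}_n$, respectively. Assume the following. (A1) For every $n\ge 1$ and all $u,v\in T\Theta$ with the same base-point, $g^n(\tilde u^n,\tilde v^n)=n\,g(\tilde u,\tilde v)$. (A2) For every $n\ge 1$ and all $u,v\in T\Theta$ with the same base-point, $g_n(\tilde u_n,\tilde v_n)=g^n(\tilde u^n,\tilde v^n)$. (A3) Let $\mathcal{T}'$ be the set of all pairs $(P,A)$ with $P$ a probability measure on $\mathbb{R}^d$ and $A$ a signed measure on $\mathbb{R}^d$. There exist a subset $\mathcal{T}\subseteq\mathcal{T}'$ and a function $H:\mathcal{T}\to\mathbb{R}$ such that: (i) for every $n\ge 1$, $T\mathcal{N}_n\subseteq\mathcal{T}$ and $\sqrt{g_n(\tilde u_n,\tilde u_n)}=H(\tilde u_n)$ for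 every $\tilde u_n\in T\mathcal{N}_n$; (ii) for every linear function $f:\mathbb{R}^d\to\mathbb{R}$ (so $f(0)=0$), $(\Phi,f\Phi)\in\mathcal{T}$, where $\Phi$ is the standard normal distribution on $\mathbb{R}^d$ (mean $0$ and identity variance-covariance matrix); (iii) for every linear function $f:\mathbb{R}^d\to\mathbb{R}$ and every sequence $(P_n)_{n\ge1}$ of probability measures on $\mathbb{R}^d$ such that each $P_n$ has mean $0$ and identity variance-covariance matrix, $(P_n,fP_n)\in\mathcal{T}$ for all $n$, $H(P_n,fP_n)$ is constant in $n$, and $P_n$ converges weakly to $\Phi$, one has $H(P_n,fP_n)=H(\Phi,f\Phi)$; (iv) for every $(P,A)\in\mathcal{T}$ and every invertible affine transformation $L$ of $\mathbb{R}^d$ (i.e. $L(x)=Mx+b$ with $M$ an invertible $d\times d$ matrix and $b\in\mathbb{R}^d$), $(L_*P,L_*A)\in\mathcal{T}$ and $H(L_*P,L_*A)=H(P,A)$. Let $g^F$, $g^{nF}$, $g_n^F$ be the Fisher information metrics on $\mathcal{M}$, $\mathcal{M}^n$, $\mathcal{N}_n$, respectively. Then there is some $c>0$ such that $g=c\,g^F$, $g^n=c\,g^{nF}$ and $g_n=c\,g_n^F$ for every integer $n\ge1$.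
   Context: **Exponential family.** Let $\mu$ be a (Borel) measure on $\mathbb{R}^m$ with support $\mathcal{X}\subseteq\mathbb{R}^m$, let $T:\mathcal{X}\to\mathbb{R}^d$ be measurable, and let $$\Theta=\Big\{\theta\in\mathbb{R}^d \;\Big|\; \int \exp(\theta\cdot T)\,d\mu<\infty\Big\},$$ where $\cdot$ is the Euclidean inner product. For $\theta\in\Theta$ put $Z(\theta)=\int\exp(\theta\cdot T)\,d\mu$ and $p_\theta(x)=\exp(\theta\cdot T(x))/Z(\theta)$ for $x\in\mathcal{X}$. Assume $\Theta$ is a non-empty open subset of $\mathbb{R}^d$, and that $T$ is full rank, in the sense that its image is not contained in any $(d-1)$-dimensional (affine) hyperplane of $\mathbb{R}^d$. Then $\mathcal{M}=\{p_\theta\mu\mid\theta\in\Theta\}$, a set of probability measures, is called a regular exponential family of order $d$ with dominating measure $\mu$ and canonical sufficient statistic $T$. Here $p\mu$ denotes the measure with density $p$ with respect to $\mu$. It is also assumed that the parameterisation $\theta\mapsto p_\theta\mu$ is non-singular: it is injective, and for every $\theta\in\Theta$ and every non-zero $a\in\mathbb{R}^d$ the signed measure $\sum_{i=1}^d a_i(\partial p_\theta/\partial\theta_i)\mu$ is non-zero. **IID extensions.** For $n\ge1$, $\mathcal{M}^n=\{P^n\mid P\in\mathcal{M}\}$, where $P^n=P\times\dots\times P$ is the product measure on $\mathcal{X}^n$. Equivalently $\mathcal{M}^n=\{p_\theta^{(n)}\mu^n\mid\theta\in\Theta\}$, where $\mu^n$ is the $n$-fold product measure and $p_\theta^{(n)}(x_1,\dots,x_n)=p_\theta(x_1)\cdots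 p_\theta(x_n)=\exp\big(n\theta\cdot T_n(x_1,\dots,x_n)-n\log Z(\theta)\big)$, with $T_n(x_1,\dots,x_n)=(T(x_1)+\dots+T(x_n))/n$. **Push-forward.** For a measurable map $\phi$ and a (signed) measure $P$, $(\phi_*P)(U)=P(\phi^{-1}(U))$ for measurable $U$. **Natural exponential families.** For $n\ge1$, $\mathcal{N}_n=\{(T_n)_*P^n\mid P^n\in\mathcal{M}^n\}$, a set of probability measures on $\mathbb{R}^d$. Then $\mathcal{N}_n=\{q_\theta^n\nu_n\mid\theta\in\Theta\}$, where $\nu_n=(T_n)_*\mu^n$ is a measure on $\mathbb{R}^d$ not depending on $\theta$, and $q_\theta^n(y)=\exp(n\theta\cdot y-n\log Z(\theta))$ for $y\in\mathbb{R}^d$ (the measure with parameter $\theta$ being $(T_n)_*(p_\theta\mu)^n=q_\theta^n\nu_n$). **Tangent vectors.** $T\Theta=\Theta\times\mathbb{R}^d$; an element $u=(\theta,a)$ is a tangent vector with base-point $\theta$. The corresponding tangent vectors are: - to $\mathcal{M}$: $\tilde u=(P,A)$ with $P=p_\theta\mu$, $A=\sum_{i=1}^d a_i(\partial p_\theta/\partial\theta_i)\mu$; - to $\mathcal{M}^n$: $\tilde u^n=(P^n,A^{(n)})$ with $P^n=p_\theta^{(n)}\mu^n$, $A^{(n)}=\sum_{i=1}^d a_i(\partial p_\theta^{(n)}/\partial\theta_i)\mu^n$; - to $\mathcal{N}_n$: $\tilde u_n=(Q_n,A_n)$ with $Q_n=q_\theta^n\nu_n$, $A_n=\sum_{i=1}^d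 a_i(\partial q_\theta^n/\partial\theta_i)\nu_n$. The tangent bundles are $T\mathcal{M}=\{\tilde u\mid u\in T\Theta\}$, $T\mathcal{M}^n=\{\tilde u^n\mid u\in T\Theta\}$, $T\mathcal{N}_n=\{\tilde u_n\mid u\in T\Theta\}$. The tangent space at a point of the model is the set of tangent vectors with that point as first component; it is a vector space with operations $s(P,A)+t(P,B)=(P,sA+tB)$. **Riemannian metrics.** A Riemannian metric on any of these models is a choice of (positive definite) inner product on each tangent space, varying smoothly with the base-point (i.e. smoothly in $\theta\in\Theta$). **Fisher information metric.** On each of the models $\mathcal{M}$, $\mathcal{M}^n$, $\mathcal{N}_n$, the Fisher information metric is the Riemannian metric given, for tangent vectors $(P,A)$ and $(P,B)$ with the same base-point $P$, by $$\big((P,A),(P,B)\big)\mapsto\int\frac{dA}{dP}\,\frac{dB}{dP}\,dP,$$ where $dA/dP$ and $dB/dP$ are Radon–Nikodym derivatives. *)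

theory Defs
  imports "HOL-Probability.Probability"
begin

section \<open>Signed measures\<close>

text \<open>
  A finite signed measure on \<open>M\<close> is a countably additive real set function on \<open>sets M\<close>. It is
  normalised to be zero off \<open>sets M\<close>, as \<^const>\<open>emeasure\<close> is, so that equality of signed
  measures is equality of functions.
\<close>

type_synonym 'x signed = "'x set \<Rightarrow> real"

definition signed_measure :: "'x measure \<Rightarrow> 'x signed \<Rightarrow> bool" where
  "signed_measure M A \<longleftrightarrow>
     A {} = 0 \<and>
     (\<forall>F :: nat \<Rightarrow> 'x set. range F \<subseteq> sets M \<longrightarrow> disjoint_family F \<longrightarrow>
        (\<lambda>i. A (F i)) sums A (\<Union>i. F i)) \<and>
     (\<forall>U. U \<notin> sets M \<longrightarrow> A U = 0)"

definition signed_density :: "'x measure \<Rightarrow> ('x \<Rightarrow> real) \<Rightarrow> 'x signed" where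
  "signed_density M f = (\<lambda>U. if U \<in> sets M then (LINT x:U|M. f x) else 0)"

definition signed_distr :: "'x measure \<Rightarrow> 'y measure \<Rightarrow> ('x \<Rightarrow> 'y) \<Rightarrow> 'x signed \<Rightarrow> 'y signed" where
  "signed_distr M N \<phi> A = (\<lambda>U. if U \<in> sets N then A (\<phi> -` U \<inter> space M) else 0)"

text \<open>A version of the Radon-Nikodym derivative; it is unique up to \<open>P\<close>-null sets.\<close>

definition signed_RN_deriv :: "'x measure \<Rightarrow> 'x signed \<Rightarrow> 'x \<Rightarrow> real" where
  "signed_RN_deriv P A = (SOME f. integrable P f \<and> A = signed_density P f)"


section \<open>Riemannian metrics on parametrised statistical models\<close>

text \<open>
  A tangent vector is a pair of a base-point and a signed measure. A model with parameter space
  \<open>\<Theta>\<close> enters through the map \<open>\<tau>\<close> that sends \<open>(\<theta>, a) \<in> \<Theta> \<times> \<real>\<^sup>d\<close> to the corresponding tangent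
  vector to the model.
\<close>

type_synonym 'x tvec = "'x measure \<times> 'x signed"

definition tangent_bundle :: "'p set \<Rightarrow> ('p \<Rightarrow> 'p \<Rightarrow> 'x tvec) \<Rightarrow> 'x tvec set" where
  "tangent_bundle \<Theta> \<tau> = {\<tau> \<theta> a | \<theta> a. \<theta> \<in> \<Theta>}"

definition tangent_space ::
    "'p set \<Rightarrow> ('p \<Rightarrow> 'p \<Rightarrow> 'x tvec) \<Rightarrow> 'x measure \<Rightarrow> 'x tvec set" where
  "tangent_space \<Theta> \<tau> P = {v \<in> tangent_bundle \<Theta> \<tau>. fst v = P}"

definition tvec_comb :: "real \<Rightarrow> 'x tvec \<Rightarrow> real \<Rightarrow> 'x tvec \<Rightarrow> 'x tvec" where
  "tvec_comb s v t w = (fst v, \<lambda>U. s * snd v U + t * snd w U)"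

definition inner_product_on :: "'x tvec set \<Rightarrow> ('x tvec \<Rightarrow> 'x tvec \<Rightarrow> real) \<Rightarrow> bool" where
  "inner_product_on V g \<longleftrightarrow>
     (\<forall>v\<in>V. \<forall>w\<in>V. g v w = g w v) \<and>
     (\<forall>u\<in>V. \<forall>v\<in>V. \<forall>w\<in>V. \<forall>s t. g (tvec_comb s u t v) w = s * g u w + t * g v w) \<and>
     (\<forall>v\<in>V. snd v \<noteq> (\<lambda>_. 0) \<longrightarrow> g v v > 0)"

primrec C_k_on ::
    "nat \<Rightarrow> 'a::real_normed_vector set \<Rightarrow> ('a \<Rightarrow> 'b::real_normed_vector) \<Rightarrow> bool" where
  "C_k_on 0 S f \<longleftrightarrow> continuous_on S f"
| "C_k_on (Suc k) S f \<longleftrightarrow>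
     (\<forall>x\<in>S. f differentiable (at x)) \<and>
     (\<forall>v. C_k_on k S (\<lambda>x. frechet_derivative f (at x) v))"

definition smooth_on :: "'a::real_normed_vector set \<Rightarrow> ('a \<Rightarrow> 'b::real_normed_vector) \<Rightarrow> bool" where
  "smooth_on S f \<longleftrightarrow> (\<forall>k. C_k_on k S f)"

text \<open>
  Only the values \<open>g v w\<close> for \<open>v\<close>, \<open>w\<close> in a common tangent space of the model are relevant.
\<close>

definition riemannian_metric ::
    "'p::real_normed_vector set \<Rightarrow> ('p \<Rightarrow> 'p \<Rightarrow> 'x tvec) \<Rightarrow> ('x tvec \<Rightarrow> 'x tvec \<Rightarrow> real) \<Rightarrow> bool" where
  "riemannian_metric \<Theta> \<tau> g \<longleftrightarrow>
     (\<forall>P. inner_product_on (tangent_space \<Theta> \<tau> P) g) \<and>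
     (\<forall>a b. smooth_on \<Theta> (\<lambda>\<theta>. g (\<tau> \<theta> a) (\<tau> \<theta> b)))"

definition fisher_metric :: "'x tvec \<Rightarrow> 'x tvec \<Rightarrow> real" where
  "fisher_metric v w =
     (\<integral>x. signed_RN_deriv (fst v) (snd v) x * signed_RN_deriv (fst v) (snd w) x \<partial>(fst v))"

definition equals_multiple_of_fisher ::
    "'p set \<Rightarrow> ('p \<Rightarrow> 'p \<Rightarrow> 'x tvec) \<Rightarrow> ('x tvec \<Rightarrow> 'x tvec \<Rightarrow> real) \<Rightarrow> real \<Rightarrow> bool" where
  "equals_multiple_of_fisher \<Theta> \<tau> g c \<longleftrightarrow>
     (\<forall>P. \<forall>v\<in>tangent_space \<Theta> \<tau> P. \<forall>w\<in>tangent_space \<Theta> \<tau> P. g v w = c * fisher_metric v w)"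


section \<open>Exponential families\<close>

definition partial_derivative :: "'d::finite \<Rightarrow> (real^'d \<Rightarrow> real) \<Rightarrow> real^'d \<Rightarrow> real" where
  "partial_derivative i F \<theta> = deriv (\<lambda>t. F (\<theta> + t *\<^sub>R axis i 1)) 0"

definition measure_support :: "'a::topological_space measure \<Rightarrow> 'a set" where
  "measure_support \<mu> = {x. \<forall>U. open U \<and> x \<in> U \<longrightarrow> emeasure \<mu> U > 0}"

text \<open>
  The dominating measure, regarded as a measure on its support, where the statistic \<open>T\<close> lives.
  The values of \<open>T\<close> outside the support are irrelevant.
\<close>

definition dominating :: "(real^'m) measure \<Rightarrow> (real^'m) measure" where
  "dominating \<mu> = restrict_space \<mu> (measure_support \<mu>)"

definition param_space :: "(real^'m) measure \<Rightarrow> (real^'m \<Rightarrow> real^'d) \<Rightarrow> (real^'d) set" where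
  "param_space \<mu> T = {\<theta>. (\<integral>\<^sup>+x. ennreal (exp (\<theta> \<bullet> T x)) \<partial>dominating \<mu>) < \<infinity>}"

definition partition_fun ::
    "(real^'m) measure \<Rightarrow> (real^'m \<Rightarrow> real^'d) \<Rightarrow> real^'d \<Rightarrow> real" where
  "partition_fun \<mu> T \<theta> = (\<integral>x. exp (\<theta> \<bullet> T x) \<partial>dominating \<mu>)"

definition ef_density ::
    "(real^'m) measure \<Rightarrow> (real^'m \<Rightarrow> real^'d) \<Rightarrow> real^'d \<Rightarrow> real^'m \<Rightarrow> real" where
  "ef_density \<mu> T \<theta> x = exp (\<theta> \<bullet> T x) / partition_fun \<mu> T \<theta>"

definition ef_measure ::
    "(real^'m) measure \<Rightarrow> (real^'m \<Rightarrow> real^'d) \<Rightarrow> real^'d \<Rightarrow> (real^'m) measure" where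
  "ef_measure \<mu> T \<theta> = density (dominating \<mu>) (\<lambda>x. ennreal (ef_density \<mu> T \<theta> x))"

definition ef_tangent ::
    "(real^'m) measure \<Rightarrow> (real^'m \<Rightarrow> real^'d) \<Rightarrow> real^'d \<Rightarrow> real^'d \<Rightarrow> (real^'m) tvec" where
  "ef_tangent \<mu> T \<theta> a =
     (ef_measure \<mu> T \<theta>,
      signed_density (dominating \<mu>)
        (\<lambda>x. \<Sum>i\<in>UNIV. a $ i * partial_derivative i (\<lambda>\<eta>. ef_density \<mu> T \<eta> x) \<theta>))"

text \<open>
  Regular exponential family of order \<open>CARD('d)\<close> with non-singular parametrisation. The affine
  sets of dimension \<open>CARD('d) - 1\<close> are the hyperplanes.
\<close>

locale regular_exponential_family =
  fixes \<mu> :: "(real^'m) measure" and T :: "real^'m \<Rightarrow> real^'d"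
  assumes sets_mu: "sets \<mu> = sets borel"
    and measurable_T: "T \<in> dominating \<mu> \<rightarrow>\<^sub>M borel"
    and param_space_nonempty: "param_space \<mu> T \<noteq> {}"
    and param_space_open: "open (param_space \<mu> T)"
    and full_rank: "\<not> (\<exists>S. affine S \<and> aff_dim S = int CARD('d) - 1 \<and> T ` measure_support \<mu> \<subseteq> S)"
    and inj_param: "inj_on (ef_measure \<mu> T) (param_space \<mu> T)"
    and immersion: "\<And>\<theta> a. \<theta> \<in> param_space \<mu> T \<Longrightarrow> a \<noteq> 0 \<Longrightarrow> snd (ef_tangent \<mu> T \<theta> a) \<noteq> (\<lambda>_. 0)"


subsection \<open>IID extensions\<close>

text \<open>
  Points of the \<open>n\<close>-fold product of the sample space are (extensional) functions on \<open>{..<n}\<close>.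
  The base-point is taken to be the product measure itself rather than the measure with density
  \<open>iid_density \<mu> T n \<theta>\<close>. Likewise, the base-points of the natural exponential families below are
  the push-forwards of these product measures.
\<close>

definition iid_power :: "nat \<Rightarrow> 'x measure \<Rightarrow> (nat \<Rightarrow> 'x) measure" where
  "iid_power n M = PiM {..<n} (\<lambda>_. M)"

definition iid_density ::
    "(real^'m) measure \<Rightarrow> (real^'m \<Rightarrow> real^'d) \<Rightarrow> nat \<Rightarrow> real^'d \<Rightarrow> (nat \<Rightarrow> real^'m) \<Rightarrow> real" where
  "iid_density \<mu> T n \<theta> x = (\<Prod>j<n. ef_density \<mu> T \<theta> (x j))"

definition iid_tangent ::
    "(real^'m) measure \<Rightarrow> (real^'m \<Rightarrow> real^'d) \<Rightarrow> nat \<Rightarrow> real^'d \<Rightarrow> real^'d \<Rightarrow>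
     (nat \<Rightarrow> real^'m) tvec" where
  "iid_tangent \<mu> T n \<theta> a =
     (iid_power n (ef_measure \<mu> T \<theta>),
      signed_density (iid_power n (dominating \<mu>))
        (\<lambda>x. \<Sum>i\<in>UNIV. a $ i * partial_derivative i (\<lambda>\<eta>. iid_density \<mu> T n \<eta> x) \<theta>))"


subsection \<open>Natural exponential families\<close>

definition mean_statistic :: "('x \<Rightarrow> real^'d) \<Rightarrow> nat \<Rightarrow> (nat \<Rightarrow> 'x) \<Rightarrow> real^'d" where
  "mean_statistic T n x = (1 / real n) *\<^sub>R (\<Sum>j<n. T (x j))"

definition nat_dominating ::
    "(real^'m) measure \<Rightarrow> (real^'m \<Rightarrow> real^'d) \<Rightarrow> nat \<Rightarrow> (real^'d) measure" where
  "nat_dominating \<mu> T n = distr (iid_power n (dominating \<mu>)) borel (mean_statistic T n)"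

definition nat_density ::
    "(real^'m) measure \<Rightarrow> (real^'m \<Rightarrow> real^'d) \<Rightarrow> nat \<Rightarrow> real^'d \<Rightarrow> real^'d \<Rightarrow> real" where
  "nat_density \<mu> T n \<theta> y = exp (real n * (\<theta> \<bullet> y) - real n * ln (partition_fun \<mu> T \<theta>))"

definition nat_tangent ::
    "(real^'m) measure \<Rightarrow> (real^'m \<Rightarrow> real^'d) \<Rightarrow> nat \<Rightarrow> real^'d \<Rightarrow> real^'d \<Rightarrow> (real^'d) tvec" where
  "nat_tangent \<mu> T n \<theta> a =
     (distr (iid_power n (ef_measure \<mu> T \<theta>)) borel (mean_statistic T n),
      signed_density (nat_dominating \<mu> T n)
        (\<lambda>y. \<Sum>i\<in>UNIV. a $ i * partial_derivative i (\<lambda>\<eta>. nat_density \<mu> T n \<eta> y) \<theta>))"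


section \<open>Probability measures on Euclidean space\<close>

definition borel_prob :: "'a::topological_space measure \<Rightarrow> bool" where
  "borel_prob P \<longleftrightarrow> prob_space P \<and> sets P = sets borel"

definition has_mean :: "(real^'d) measure \<Rightarrow> real^'d \<Rightarrow> bool" where
  "has_mean P m \<longleftrightarrow> integrable P (\<lambda>x. x) \<and> (\<integral>x. x \<partial>P) = m"

definition has_mean_covariance :: "(real^'d) measure \<Rightarrow> real^'d \<Rightarrow> real^'d^'d \<Rightarrow> bool" where
  "has_mean_covariance P m C \<longleftrightarrow>
     has_mean P m \<and>
     (\<forall>i j. integrable P (\<lambda>x. (x $ i - m $ i) * (x $ j - m $ j)) \<and>
            (\<integral>x. (x $ i - m $ i) * (x $ j - m $ j) \<partial>P) = C $ i $ j)"

definition std_normal_measure :: "(real^'d) measure" where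
  "std_normal_measure = density lborel (\<lambda>x. ennreal (\<Prod>i\<in>UNIV. std_normal_density (x $ i)))"

text \<open>The library's \<open>weak_conv_m\<close> covers measures on the real line only.\<close>

definition converges_weakly ::
    "(nat \<Rightarrow> 'a::topological_space measure) \<Rightarrow> 'a measure \<Rightarrow> bool" where
  "converges_weakly P Q \<longleftrightarrow>
     (\<forall>h :: 'a \<Rightarrow> real. continuous_on UNIV h \<and> bounded (range h) \<longrightarrow>
        (\<lambda>n. \<integral>x. h x \<partial>P n) \<longlonglongrightarrow> (\<integral>x. h x \<partial>Q))"

end

theory Submission
  imports Defs
begin

text \<open>
  Fix a parameter \<open>\<theta>\<close> and a vector \<open>a\<close> with unit Fisher norm. Complete \<open>a\<close> to a basis that is orthonormal for
  the Fisher metric at \<open>\<theta>\<close>, with \<open>a\<close> in position \<open>i0\<close>. The basis gives affine maps that carry the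
  law of the mean statistic to a law \<open>P\<^sub>n\<close> with mean \<open>0\<close> and identity covariance, and carry the
  tangent vector \<open>a / sqrt n\<close> to \<open>x\<^bsub>i0\<^esub> P\<^sub>n\<close>. By (A1), (A2) and affine invariance, \<open>H\<close> takes the
  value \<open>sqrt (g a a)\<close> on all of these, so the multivariate central limit theorem and (A3)(iii) give
  \<open>g a a = (H (\<Phi>, x\<^bsub>i0\<^esub> \<Phi>))\<^sup>2\<close>, which depends neither on \<open>a\<close> nor on \<open>\<theta>\<close>. Since \<open>a\<close> itself is part
  of the basis, the rotation invariance of \<open>\<Phi>\<close> is not needed. Homogeneity and polarisation
  then determine \<open>g\<close>, and injectivity of the parametrisations transfers this to the tangent spaces.
\<close>

section \<open>Weak convergence and the multivariate central limit theorem\<close>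

text \<open>The rescaling by sqrt n is dictated by (A3)(iii), which asks for constant values of
  \<open>H\<close>: (A1) and (A2) multiply squared lengths by n, and the scores of the natural
  families carry a factor n, so dividing \<open>a\<close> by sqrt n makes both the length and the
  linear density of the whitened vector independent of n. Tangent vectors are defined through
  partial derivatives of densities, so the argument rests on differentiating the partition function
  under the integral. Openness of \<Theta> permits this: at an interior point T has exponential
  moments in every direction. Weak convergence in several dimensions is obtained from the scalar
  limit theorem for the projections t . x together with a tail bound uniform in n. Finally, a
  tangent space is attached to a measure and not to a parameter, so the push-forwards must also
  determine the parameter; their means do.\<close>

lemma prod_Basis_vec:
  fixes f :: "real^'d \<Rightarrow> 'a::comm_monoid_mult"
  shows "(\<Prod>b\<in>Basis. f b) = (\<Prod>i\<in>UNIV. f (axis i 1))"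
proof -
  have "inj (\<lambda>i::'d. axis i (1::real))"
    by (auto simp: inj_on_def axis_eq_axis)
  moreover have "Basis = range (\<lambda>i::'d. axis i (1::real))"
    by (auto simp: Basis_vec_def)
  ultimately show ?thesis
    using prod.reindex[of "\<lambda>i::'d. axis i (1::real)" UNIV f] by (simp add: comp_def)
qed

lemma std_normal_measure_alt:
  "(std_normal_measure :: (real^'d) measure)
     = density lborel (\<lambda>x. ennreal (\<Prod>b\<in>Basis. std_normal_density (x \<bullet> b)))"
  unfolding std_normal_measure_def prod_Basis_vec by (simp add: inner_axis)

lemma prob_space_std_normal_measure: "prob_space (std_normal_measure :: (real^'d) measure)"
proof
  have "emeasure (std_normal_measure :: (real^'d) measure) (space std_normal_measure)
      = (\<integral>\<^sup>+x. ennreal (\<Prod>b\<in>Basis. std_normal_density (x \<bullet> b)) \<partial>(lborel :: (real^'d) measure))"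
    unfolding std_normal_measure_alt by (simp add: emeasure_density)
  also have "\<dots> = (\<integral>\<^sup>+x. (\<Prod>b\<in>Basis. ennreal (std_normal_density (x \<bullet> b))) \<partial>(lborel :: (real^'d) measure))"
    by (simp add: prod_ennreal)
  also have "\<dots> = (\<Prod>b\<in>(Basis :: (real^'d) set). \<integral>\<^sup>+x. ennreal (std_normal_density x) \<partial>lborel)"
    by (rule nn_integral_lborel_prod) auto
  also have "(\<integral>\<^sup>+x. ennreal (std_normal_density x) \<partial>lborel) = 1"
    using prob_space.emeasure_space_1[OF prob_space_normal_density[of 1 0]]
    by (simp add: emeasure_density)
  finally show "emeasure (std_normal_measure :: (real^'d) measure) (space std_normal_measure) = 1"
    by simp
qed

lemma sets_std_normal_measure [simp, measurable_cong]: "sets std_normal_measure = sets borel"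
  by (simp add: std_normal_measure_def)

lemma space_std_normal_measure [simp]: "space std_normal_measure = UNIV"
  by (simp add: std_normal_measure_def)

text \<open>Density and exponential both factor over the coordinates, so Fubini leaves a product of
  scalar characteristic functions exp(-(t . b)^2 / 2), and the exponents add up to a function of
  \<open>norm t\<close> alone. The right side is kept as \<open>char\<close> at
  \<open>norm t\<close> to meet the limit of the scalar theorem for the projection on t.\<close>

lemma iexp_std_normal_measure:
  fixes t :: "real^'d"
  shows "(\<integral>x. iexp (t \<bullet> x) \<partial>std_normal_measure) = char std_normal_distribution (norm t)"
proof -
  interpret product_sigma_finite "\<lambda>_::real^'d. lborel :: real measure" ..
  have char1: "(\<integral>x. std_normal_density x *\<^sub>R iexp (s * x) \<partial>lborel) = exp (- (s\<^sup>2) / 2)"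
    and int1: "integrable lborel (\<lambda>x. std_normal_density x *\<^sub>R iexp (s * x))" for s
  proof -
    interpret N: real_distribution std_normal_distribution
      by (rule real_dist_normal_dist)
    show "(\<integral>x. std_normal_density x *\<^sub>R iexp (s * x) \<partial>lborel) = exp (- (s\<^sup>2) / 2)"
      using fun_cong[OF char_std_normal_distribution, of s]
      unfolding char_def by (subst (asm) integral_density) auto
    have "integrable std_normal_distribution (\<lambda>x. iexp (s * x))"
      by (rule N.integrable_const_bound[where B = 1]) auto
    then show "integrable lborel (\<lambda>x. std_normal_density x *\<^sub>R iexp (s * x))"
      by (subst (asm) integrable_density) auto
  qed
  have "(\<integral>x. iexp (t \<bullet> x) \<partial>std_normal_measure)
      = (\<integral>x. (\<Prod>b\<in>Basis. std_normal_density (x \<bullet> b)) *\<^sub>R iexp (t \<bullet> x) \<partial>(lborel :: (real^'d) measure))"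
    unfolding std_normal_measure_alt by (subst integral_density) (auto intro!: prod_nonneg)
  also have "\<dots> = (\<integral>x. (\<Prod>b\<in>Basis. std_normal_density (x \<bullet> b) *\<^sub>R iexp ((t \<bullet> b) * (x \<bullet> b))) \<partial>(lborel :: (real^'d) measure))"
  proof (rule Bochner_Integration.integral_cong[OF refl])
    fix x :: "real^'d"
    have "iexp (t \<bullet> x) = exp (\<Sum>b\<in>Basis. \<i> * complex_of_real ((t \<bullet> b) * (x \<bullet> b)))"
      by (subst euclidean_inner) (simp only: of_real_sum sum_distrib_left)
    also have "\<dots> = (\<Prod>b\<in>Basis. iexp ((t \<bullet> b) * (x \<bullet> b)))"
      by (simp add: exp_sum)
    finally show "(\<Prod>b\<in>Basis. std_normal_density (x \<bullet> b)) *\<^sub>R iexp (t \<bullet> x)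
        = (\<Prod>b\<in>Basis. std_normal_density (x \<bullet> b) *\<^sub>R iexp ((t \<bullet> b) * (x \<bullet> b)))"
      by (simp only: scaleR_conv_of_real prod.distrib of_real_prod)
  qed
  also have "\<dots> = (\<integral>x. (\<Prod>b\<in>Basis. std_normal_density (x b) *\<^sub>R iexp ((t \<bullet> b) * x b)) \<partial>Pi\<^sub>M (Basis :: (real^'d) set) (\<lambda>_. lborel))"
    by (subst lborel_eq, subst integral_distr) simp_all
  also have "\<dots> = (\<Prod>b\<in>Basis. \<integral>x. std_normal_density x *\<^sub>R iexp ((t \<bullet> b) * x) \<partial>lborel)"
    using int1 by (intro product_integral_prod) (simp_all only: finite_Basis of_real_mult)
  also have "\<dots> = (\<Prod>b\<in>Basis. exp (- ((t \<bullet> b)\<^sup>2) / 2))"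
    by (simp only: char1 of_real_prod)
  also have "\<dots> = exp (- ((norm t)\<^sup>2) / 2)"
  proof -
    have "(\<Sum>b\<in>Basis. - ((t \<bullet> b)\<^sup>2) / 2) = - (\<Sum>b\<in>Basis. (t \<bullet> b) * (t \<bullet> b)) / 2"
      by (simp add: sum_negf sum_divide_distrib power2_eq_square)
    also have "(\<Sum>b\<in>Basis. (t \<bullet> b) * (t \<bullet> b)) = (norm t)\<^sup>2"
      by (simp only: power2_norm_eq_inner) (rule euclidean_inner[symmetric])
    finally have "exp (\<Sum>b\<in>Basis. - ((t \<bullet> b)\<^sup>2) / 2) = exp (- ((norm t)\<^sup>2) / 2)"
      by (rule arg_cong)
    then show ?thesis
      by (simp only: exp_sum[OF finite_Basis])
  qed
  finally show ?thesis
    by (simp add: char_std_normal_distribution)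
qed

lemma Re_iexp_mult_iexp: "Re (iexp s * iexp y) = cos (y + s)"
proof -
  have "iexp s * iexp y = cis (y + s)"
    unfolding cis_conv_exp by (simp add: exp_add[symmetric] ring_distribs add.commute)
  then show ?thesis by simp
qed
text \<open>Cosines with a phase replace characteristic functions from here on: s = 0 gives the real
  part and s = -pi/2 the imaginary part, so all test functions stay real.\<close>

lemma integral_cos_conv_iexp:
  assumes "prob_space M" "f \<in> borel_measurable M"
  shows "(\<integral>x. cos (f x + s) \<partial>M) = Re (iexp s * (\<integral>x. iexp (f x) \<partial>M))"
proof -
  interpret prob_space M by fact
  have "integrable M (\<lambda>x. iexp (f x))"
    using assms(2) by (intro integrable_const_bound[where B = 1]) auto
  then have i: "integrable M (\<lambda>x. iexp s * iexp (f x))"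
    by (rule integrable_mult_right)
  have "Re (iexp s * (\<integral>x. iexp (f x) \<partial>M)) = Re (\<integral>x. iexp s * iexp (f x) \<partial>M)"
    by (simp only: integral_mult_right_zero)
  also have "\<dots> = (\<integral>x. Re (iexp s * iexp (f x)) \<partial>M)"
    by (rule integral_Re[OF i, symmetric])
  also have "\<dots> = (\<integral>x. cos (f x + s) \<partial>M)"
    by (simp only: Re_iexp_mult_iexp)
  finally show ?thesis ..
qed
lemma integral_cos_std_normal_measure:
  fixes t :: "real^'d"
  shows "(\<integral>x. cos (t \<bullet> x + s) \<partial>std_normal_measure) = (\<integral>z. cos (norm t * z + s) \<partial>std_normal_distribution)"
proof -
  have "(\<integral>x. cos (t \<bullet> x + s) \<partial>std_normal_measure) = Re (iexp s * char std_normal_distribution (norm t))"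
    by (subst integral_cos_conv_iexp[OF prob_space_std_normal_measure])
       (simp_all only: iexp_std_normal_measure, measurable)
  also have "\<dots> = (\<integral>z. cos (norm t * z + s) \<partial>std_normal_distribution)"
    unfolding char_def
    by (rule integral_cos_conv_iexp[symmetric]) (simp_all add: prob_space_normal_density)
  finally show ?thesis .
qed

section \<open>Trigonometric polynomials and weak convergence\<close>

text \<open>The phase s brings in the sines as well, and the product-to-sum formulas make the set an
  algebra. It is thus a class for Stone-Weierstrass whose integrals are controlled by the cosine
  integrals alone.\<close>

inductive_set trig_poly :: "('a::real_inner \<Rightarrow> real) set" where
  cos: "(\<lambda>x. c * cos (t \<bullet> x + s)) \<in> trig_poly"
| add: "f \<in> trig_poly \<Longrightarrow> g \<in> trig_poly \<Longrightarrow> (\<lambda>x. f x + g x) \<in> trig_poly"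

lemma trig_poly_const: "(\<lambda>_. c) \<in> trig_poly"
  using trig_poly.cos[of c 0 0] by simp

lemma trig_poly_mult:
  assumes "f \<in> trig_poly" "g \<in> trig_poly"
  shows "(\<lambda>x. f x * g x) \<in> trig_poly"
  using assms(1)
proof induction
  case (cos c t s)
  show ?case using assms(2)
  proof induction
    case (cos c' t' s')
    have "(\<lambda>x. c * cos (t \<bullet> x + s) * (c' * cos (t' \<bullet> x + s')))
        = (\<lambda>x. (c * c' / 2) * cos ((t - t') \<bullet> x + (s - s')) + (c * c' / 2) * cos ((t + t') \<bullet> x + (s + s')))"
    proof
      fix x
      have "cos ((t - t') \<bullet> x + (s - s')) = cos ((t \<bullet> x + s) - (t' \<bullet> x + s'))"
        and "cos ((t + t') \<bullet> x + (s + s')) = cos ((t \<bullet> x + s) + (t' \<bullet> x + s'))"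
        by (auto simp: algebra_simps inner_simps)
      then show "c * cos (t \<bullet> x + s) * (c' * cos (t' \<bullet> x + s'))
          = (c * c' / 2) * cos ((t - t') \<bullet> x + (s - s')) + (c * c' / 2) * cos ((t + t') \<bullet> x + (s + s'))"
        unfolding cos_add cos_diff by (simp only:) (simp add: field_simps)
    qed
    then show ?case by (simp only:) (intro trig_poly.intros)
  next
    case (add f g)
    then show ?case by (auto simp: ring_distribs intro: trig_poly.add)
  qed
next
  case (add f g)
  then show ?case by (auto simp: ring_distribs intro: trig_poly.add)
qed

lemma trig_poly_measurable:
  assumes "f \<in> trig_poly"
  shows "f \<in> borel_measurable (borel :: 'a::euclidean_space measure)"
  using assms by induction auto

lemma trig_poly_bounded:
  assumes "f \<in> trig_poly"
  shows "\<exists>B. \<forall>x. \<bar>f x\<bar> \<le> B"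
  using assms
proof induction
  case (cos c t s)
  show ?case
    by (rule exI[of _ "\<bar>c\<bar>"]) (auto simp: abs_mult mult_left_le)
next
  case (add f g)
  then obtain B B' where "\<forall>x. \<bar>f x\<bar> \<le> B" "\<forall>x. \<bar>g x\<bar> \<le> B'" by blast
  then have "\<bar>f x + g x\<bar> \<le> B + B'" for x
    by (meson abs_triangle_ineq add_mono order_trans)
  then show ?case by blast
qed

lemma trig_poly_integrable:
  assumes "f \<in> trig_poly" "borel_prob (P :: 'a::euclidean_space measure)"
  shows "integrable P f"
proof -
  interpret prob_space P using assms by (simp add: borel_prob_def)
  have [measurable_cong]: "sets P = sets borel" using assms by (simp add: borel_prob_def)
  obtain B where "\<forall>x. \<bar>f x\<bar> \<le> B" using trig_poly_bounded[OF assms(1)] by blast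
  then show ?thesis
    using trig_poly_measurable[OF assms(1)] by (intro integrable_const_bound[where B = B]) auto
qed

lemma trig_poly_tendsto:
  fixes P :: "nat \<Rightarrow> 'a::euclidean_space measure"
  assumes "f \<in> trig_poly" "\<And>n. n \<ge> 1 \<Longrightarrow> borel_prob (P n)" "borel_prob Q"
    and "\<And>t s. (\<lambda>n. \<integral>x. cos (t \<bullet> x + s) \<partial>P n) \<longlonglongrightarrow> (\<integral>x. cos (t \<bullet> x + s) \<partial>Q)"
  shows "(\<lambda>n. \<integral>x. f x \<partial>P n) \<longlonglongrightarrow> (\<integral>x. f x \<partial>Q)"
  using assms(1)
proof induction
  case (cos c t s)
  show ?case using assms(4)[of t s] by (simp add: tendsto_mult_left)
next
  case (add f g)
  have "(\<lambda>n. (\<integral>x. f x \<partial>P n) + (\<integral>x. g x \<partial>P n)) \<longlonglongrightarrow> (\<integral>x. f x \<partial>Q) + (\<integral>x. g x \<partial>Q)"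
    by (intro tendsto_add add)
  moreover have "(\<integral>x. f x + g x \<partial>Q) = (\<integral>x. f x \<partial>Q) + (\<integral>x. g x \<partial>Q)"
    using add assms by (intro Bochner_Integration.integral_add trig_poly_integrable)
  \<comment> \<open>Splitting the integral of a sum needs integrability, hence
    \<open>borel_prob (P n)\<close>, which is available only from n = 1 on.\<close>
  moreover have "\<forall>\<^sub>F n in sequentially. (\<integral>x. f x + g x \<partial>P n) = (\<integral>x. f x \<partial>P n) + (\<integral>x. g x \<partial>P n)"
    using eventually_ge_at_top[of 1]
    by eventually_elim
       (use add assms in \<open>intro Bochner_Integration.integral_add trig_poly_integrable; simp\<close>)
  ultimately show ?case
    by (simp add: tendsto_cong)
qed

text \<open>The substitution \<open>x\<^sub>i \<mapsto> sin (\<omega> x\<^sub>i)\<close> maps the cube \<open>[-R, R]\<^sup>d\<close> homeomorphically onto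
  \<open>[-1, 1]\<^sup>d\<close> for \<open>\<omega> = \<pi> / (2 R)\<close>, and turns polynomials into trigonometric polynomials. Thus a
  uniform approximation on \<open>[-1, 1]\<^sup>d\<close> gives one that also stays bounded off the cube.\<close>

lemma trig_poly_approx:
  fixes h :: "real^'d \<Rightarrow> real"
  assumes cont: "continuous_on UNIV h" and B: "\<And>x. \<bar>h x\<bar> \<le> B" and R: "R > 0" and e: "e > 0"
  obtains f where "f \<in> trig_poly" "\<And>x. \<bar>f x\<bar> \<le> B + e"
    "\<And>x. (\<And>i. \<bar>x $ i\<bar> \<le> R) \<Longrightarrow> \<bar>h x - f x\<bar> \<le> e"
proof -
  define \<omega> where "\<omega> = pi / (2 * R)"
  define \<sigma> :: "real^'d \<Rightarrow> real^'d" where "\<sigma> x = (\<chi> i. sin (\<omega> * x $ i))" for x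
  define S :: "(real^'d) set" where "S = cbox (- 1) 1"
  have S: "y \<in> S \<longleftrightarrow> (\<forall>i. -1 \<le> y $ i \<and> y $ i \<le> 1)" for y
    by (simp add: S_def mem_box_cart)
  \<comment> \<open>\<open>G\<close> is h in the coordinate y = \<open>\<sigma> x\<close>. On the
    cube \<open>G (\<sigma> x)\<close> is h x; off the cube it is h at some other point, so the
    bound \<open>B\<close> survives there.\<close>
  define G :: "real^'d \<Rightarrow> real" where "G y = h (\<chi> i. arcsin (y $ i) / \<omega>)" for y
  define A where "A = {G :: real^'d \<Rightarrow> real. continuous_on S G \<and> G \<circ> \<sigma> \<in> trig_poly}"
  have \<sigma>S: "\<sigma> x \<in> S" for x by (simp add: S \<sigma>_def)
  have \<omega>: "\<omega> > 0" using R by (simp add: \<omega>_def)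
  have ycont: "continuous_on S (\<lambda>y. y $ i)" for i
    by (intro continuous_intros)
  interpret function_ring_on A S
  proof
    show "compact S" by (simp add: S_def compact_cbox)
    show "continuous_on S f" if "f \<in> A" for f using that by (simp add: A_def)
    show "(\<lambda>x. f x + g x) \<in> A" if "f \<in> A" "g \<in> A" for f g
      using that trig_poly.add[of "f \<circ> \<sigma>" "g \<circ> \<sigma>"] by (auto simp: A_def comp_def intro!: continuous_intros)
    show "(\<lambda>x. f x * g x) \<in> A" if "f \<in> A" "g \<in> A" for f g
      using that trig_poly_mult[of "f \<circ> \<sigma>" "g \<circ> \<sigma>"] by (auto simp: A_def comp_def intro!: continuous_intros)
    show "(\<lambda>_. c) \<in> A" for c
      using trig_poly_const by (auto simp: A_def comp_def)
    show "\<exists>f\<in>A. f x \<noteq> f y" if "x \<noteq> y" for x y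
    proof -
      obtain i where i: "x $ i \<noteq> y $ i" using \<open>x \<noteq> y\<close> by (auto simp: vec_eq_iff)
      \<comment> \<open>The coordinates separate points, and they belong to \<open>A\<close> because
        a sine is a cosine with phase -pi/2.\<close>
      have "(\<lambda>y. y $ i) \<circ> \<sigma> = (\<lambda>x. 1 * cos ((\<omega> *\<^sub>R axis i 1) \<bullet> x + (- pi / 2)))"
        by (auto simp: \<sigma>_def fun_eq_iff inner_axis' cos_diff)
      also have "\<dots> \<in> trig_poly" by (rule trig_poly.cos)
      finally have "(\<lambda>y. y $ i) \<in> A" using ycont by (simp add: A_def)
      with i show ?thesis by (intro bexI[of _ "\<lambda>y. y $ i"])
    qed
  qed
  have "continuous_on S (\<lambda>y. \<chi> i. arcsin (y $ i) / \<omega>)"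
    using \<omega> by (intro continuous_intros continuous_on_vec_lambda) (auto simp: S)
  then have "continuous_on S G"
    unfolding G_def by (rule continuous_on_compose2[OF cont]) auto
  from Stone_Weierstrass_basic[OF this e] obtain p
    where p: "p \<in> A" "\<And>y. y \<in> S \<Longrightarrow> \<bar>G y - p y\<bar> < e" by blast
  show ?thesis
  proof
    show "p \<circ> \<sigma> \<in> trig_poly" using p by (simp add: A_def)
    have "\<bar>G y\<bar> \<le> B" for y by (simp add: G_def B)
    then show "\<bar>(p \<circ> \<sigma>) x\<bar> \<le> B + e" for x
      using p(2)[OF \<sigma>S, of x] by (smt (verit) comp_apply)
    show "\<bar>h x - (p \<circ> \<sigma>) x\<bar> \<le> e" if x: "\<And>i. \<bar>x $ i\<bar> \<le> R" for x
    proof -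
      have "arcsin (sin (\<omega> * x $ i)) = \<omega> * x $ i" for i
      proof (rule arcsin_sin)
        have "\<bar>\<omega> * x $ i\<bar> \<le> \<omega> * R"
          using x[of i] \<omega> by (simp add: abs_mult)
        also have "\<omega> * R = pi / 2" using R by (simp add: \<omega>_def)
        finally have "\<bar>\<omega> * x $ i\<bar> \<le> pi / 2" .
        then show "- (pi / 2) \<le> \<omega> * x $ i" "\<omega> * x $ i \<le> pi / 2" by auto
      qed
      then have "G (\<sigma> x) = h x"
        using \<omega> by (simp add: G_def \<sigma>_def)
      then show ?thesis using p(2)[OF \<sigma>S, of x] by simp
    qed
  qed
qed

text \<open>Uniform tightness supplies one cube that carries all but mass e of \<open>Q\<close> and
  of every \<open>P n\<close> with n \<ge> 1. A trigonometric polynomial close to h on that cube and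
  bounded everywhere then replaces h with an error that does not depend on n, and its own integrals
  converge by \<open>lim\<close>.\<close>

lemma converges_weaklyI_trig:
  fixes P :: "nat \<Rightarrow> (real^'d) measure"
  assumes P: "\<And>n. n \<ge> 1 \<Longrightarrow> borel_prob (P n)" and Q: "borel_prob Q"
    and lim: "\<And>t s. (\<lambda>n. \<integral>x. cos (t \<bullet> x + s) \<partial>P n) \<longlonglongrightarrow> (\<integral>x. cos (t \<bullet> x + s) \<partial>Q)"
    and tight: "\<And>e. e > 0 \<Longrightarrow> \<exists>R>0. (\<forall>n\<ge>1. measure (P n) {x. \<exists>i. \<bar>x $ i\<bar> > R} \<le> e)
        \<and> measure Q {x. \<exists>i. \<bar>x $ i\<bar> > R} \<le> e"
  shows "converges_weakly P Q"
  unfolding converges_weakly_def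
proof safe
  fix h :: "real^'d \<Rightarrow> real"
  assume h: "continuous_on UNIV h" "bounded (range h)"
  then obtain B where B: "\<And>x. \<bar>h x\<bar> \<le> B" and "B > 0"
    unfolding bounded_pos by auto
  \<comment> \<open>Two parts of the error: e on the cube, and |h| + |f| \<le> 2 B + e off it, on a
    set of mass at most e.\<close>
  have approx: "\<bar>(\<integral>x. h x \<partial>M) - (\<integral>x. f x \<partial>M)\<bar> \<le> e + (2 * B + e) * e"
    if M: "borel_prob M" and f: "f \<in> trig_poly" "\<And>x. \<bar>f x\<bar> \<le> B + e"
      "\<And>x. (\<And>i. \<bar>x $ i\<bar> \<le> R) \<Longrightarrow> \<bar>h x - f x\<bar> \<le> e"
      and m: "measure M {x. \<exists>i. \<bar>x $ i\<bar> > R} \<le> e" and e: "e > 0" for M f e R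
  proof -
    interpret prob_space M using M by (simp add: borel_prob_def)
    have [measurable_cong, simp]: "sets M = sets borel" using M by (simp add: borel_prob_def)
    let ?A = "{x::real^'d. \<exists>i. \<bar>x $ i\<bar> > R}"
    have A[measurable]: "?A \<in> sets borel" by measurable
    have [measurable]: "h \<in> borel_measurable borel"
      using h(1) by (rule borel_measurable_continuous_onI)
    have hi: "integrable M h"
      using B by (intro integrable_const_bound[where B = B]) auto
    have fi: "integrable M f" by (rule trig_poly_integrable) fact+
     have [simp]: "space M = UNIV"
      using sets_eq_imp_space_eq[OF \<open>sets M = sets borel\<close>] by simp
    have "\<bar>(\<integral>x. h x \<partial>M) - (\<integral>x. f x \<partial>M)\<bar> = \<bar>\<integral>x. h x - f x \<partial>M\<bar>"
      using hi fi by simp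
    also have "\<dots> \<le> (\<integral>x. \<bar>h x - f x\<bar> \<partial>M)"
      by (rule integral_abs_bound)
    also have "\<dots> \<le> (\<integral>x. e + (2 * B + e) * indicator ?A x \<partial>M)"
    proof (rule integral_mono)
      show "integrable M (\<lambda>x. e + (2 * B + e) * indicator ?A x)"
        by (intro Bochner_Integration.integrable_add integrable_mult_right integrable_const
            integrable_real_indicator) (auto simp: emeasure_eq_measure)
      show "\<bar>h x - f x\<bar> \<le> e + (2 * B + e) * indicator ?A x" for x
      proof (cases "x \<in> ?A")
        case True
        have "\<bar>h x - f x\<bar> \<le> \<bar>h x\<bar> + \<bar>f x\<bar>" by simp
        with True B[of x] f(2)[of x] e show ?thesis by (simp add: indicator_def)
      next
        case False
        then have "\<bar>h x - f x\<bar> \<le> e" by (intro f(3)) (auto simp: not_less)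
        with False show ?thesis by simp
      qed
    qed (use hi fi in auto)
    also have "\<dots> = e + (2 * B + e) * measure M ?A"
      by (subst Bochner_Integration.integral_add) (use prob_space in \<open>auto simp: emeasure_eq_measure intro!: integrable_real_indicator\<close>)
    also have "\<dots> \<le> e + (2 * B + e) * e"
      using m e \<open>B > 0\<close> by (intro add_left_mono mult_left_mono) auto
    finally show ?thesis .
  qed
  show "(\<lambda>n. \<integral>x. h x \<partial>P n) \<longlonglongrightarrow> (\<integral>x. h x \<partial>Q)"
  proof (rule LIMSEQ_I)
    fix r :: real assume r: "r > 0"
    \<comment> \<open>Three errors of size \<open>e + (2 * B + e) * e\<close> must fit below r: h to
      f under \<open>P n\<close>, f from \<open>P n\<close> to \<open>Q\<close>, f to h under
      \<open>Q\<close>. With e \<le> 1 each is at most \<open>(2 * B + 2) * e\<close>; the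
      \<open>+ 1\<close> in the denominator leaves room for a strict inequality.\<close>
    define e where "e = min 1 (r / (3 * (2 * B + 2) + 1))"
    have e: "e > 0" "e \<le> 1" using r \<open>B > 0\<close> by (auto simp: e_def)
    have "3 * (e + (2 * B + e) * e) \<le> 3 * ((2 * B + 2) * e)"
      using e \<open>B > 0\<close> by (simp add: algebra_simps)
    also have "\<dots> = (3 * (2 * B + 2)) * e" by simp
    also have "\<dots> < (3 * (2 * B + 2) + 1) * e" using e by (simp add: algebra_simps)
    also have "\<dots> \<le> (3 * (2 * B + 2) + 1) * (r / (3 * (2 * B + 2) + 1))"
      using \<open>B > 0\<close> by (intro mult_left_mono) (auto simp: e_def)
    also have "\<dots> = r" using \<open>B > 0\<close> by simp
    finally have er: "3 * (e + (2 * B + e) * e) < r" .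
    obtain R where R: "R > 0" "\<And>n. n \<ge> 1 \<Longrightarrow> measure (P n) {x. \<exists>i. \<bar>x $ i\<bar> > R} \<le> e"
      "measure Q {x. \<exists>i. \<bar>x $ i\<bar> > R} \<le> e"
      using tight[OF e(1)] by blast
    obtain f where f: "f \<in> trig_poly" "\<And>x. \<bar>f x\<bar> \<le> B + e"
      "\<And>x. (\<And>i. \<bar>x $ i\<bar> \<le> R) \<Longrightarrow> \<bar>h x - f x\<bar> \<le> e"
      using trig_poly_approx[OF h(1) B R(1) e(1)] by metis
    have "(\<lambda>n. \<integral>x. f x \<partial>P n) \<longlonglongrightarrow> (\<integral>x. f x \<partial>Q)"
      using f(1) P Q lim by (rule trig_poly_tendsto)
    then obtain N where N: "\<And>n. n \<ge> N \<Longrightarrow> \<bar>(\<integral>x. f x \<partial>P n) - (\<integral>x. f x \<partial>Q)\<bar> < e + (2 * B + e) * e"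
      using LIMSEQ_D[of "\<lambda>n. \<integral>x. f x \<partial>P n" "\<integral>x. f x \<partial>Q" "e + (2 * B + e) * e"] e \<open>B > 0\<close>
      by (auto simp: add_pos_pos)
    show "\<exists>N. \<forall>n\<ge>N. norm ((\<integral>x. h x \<partial>P n) - (\<integral>x. h x \<partial>Q)) < r"
    proof (intro exI allI impI)
      fix n assume n: "n \<ge> max 1 N"
      have "\<bar>(\<integral>x. h x \<partial>P n) - (\<integral>x. f x \<partial>P n)\<bar> \<le> e + (2 * B + e) * e"
        using n by (intro approx[OF P f R(2) e(1)]) auto
      moreover have "\<bar>(\<integral>x. h x \<partial>Q) - (\<integral>x. f x \<partial>Q)\<bar> \<le> e + (2 * B + e) * e"
        by (intro approx[OF Q f R(3) e(1)])
      ultimately show "norm ((\<integral>x. h x \<partial>P n) - (\<integral>x. h x \<partial>Q)) < r"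
        using N[of n] n er by simp
    qed
  qed
qed

section \<open>Moments and limits of sums under product measures\<close>

lemma integral_iid_component:
  fixes f :: "'a \<Rightarrow> 'b::{banach, second_countable_topology}"
  assumes "prob_space M" "j < n" "f \<in> borel_measurable M"
  shows "(\<integral>x. f (x j) \<partial>iid_power n M) = (\<integral>x. f x \<partial>M)"
    and "integrable (iid_power n M) (\<lambda>x. f (x j)) \<longleftrightarrow> integrable M f"
proof -
  have m: "(\<lambda>x. x j) \<in> iid_power n M \<rightarrow>\<^sub>M M"
    using assms unfolding iid_power_def by (intro measurable_component_singleton) auto
  have d: "distr (iid_power n M) M (\<lambda>x. x j) = M"
    using assms unfolding iid_power_def by (intro distr_PiM_component) auto
  show "(\<integral>x. f (x j) \<partial>iid_power n M) = (\<integral>x. f x \<partial>M)"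
    using integral_distr[OF m assms(3)] unfolding d ..
  show "integrable (iid_power n M) (\<lambda>x. f (x j)) \<longleftrightarrow> integrable M f"
    using integrable_distr_eq[OF m assms(3)] unfolding d ..
qed

lemma integral_iid_two_components:
  fixes f g :: "'a \<Rightarrow> real"
  assumes "prob_space M" "j < n" "k < n" "j \<noteq> k" "integrable M f" "integrable M g"
  shows "integrable (iid_power n M) (\<lambda>x. f (x j) * g (x k))"
    and "(\<integral>x. f (x j) * g (x k) \<partial>iid_power n M) = (\<integral>x. f x \<partial>M) * (\<integral>x. g x \<partial>M)"
proof -
  interpret M: prob_space M by fact
  interpret product_prob_space "\<lambda>_::nat. M" "{..<n}" ..
  \<comment> \<open>Padding with the constant 1 turns the two-factor function into a full product
    over the n coordinates, to which Fubini applies.\<close>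
  define h where "h i = (if i = j then f else if i = k then g else (\<lambda>_. 1))" for i
  have "integrable M (h i)" for i
    using assms by (auto simp: h_def)
  note h = product_integrable_prod[of "{..<n}" h] product_integral_prod[of "{..<n}" h, OF _ this]
  have prod_eq: "(\<Prod>i\<in>{..<n}. F i) = F j * F k" if "\<And>i. i \<noteq> j \<Longrightarrow> i \<noteq> k \<Longrightarrow> F i = 1" for F :: "nat \<Rightarrow> real"
  proof -
    have "(\<Prod>i\<in>{..<n}. F i) = (\<Prod>i\<in>{j, k}. F i)"
      using assms that by (intro prod.mono_neutral_right) auto
    then show ?thesis using \<open>j \<noteq> k\<close> by simp
  qed
  have "(\<Prod>i\<in>{..<n}. h i (x i)) = f (x j) * g (x k)" for x
    by (subst prod_eq) (use \<open>j \<noteq> k\<close> in \<open>auto simp: h_def\<close>)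
  moreover have "(\<Prod>i\<in>{..<n}. integral\<^sup>L M (h i)) = (\<integral>x. f x \<partial>M) * (\<integral>x. g x \<partial>M)"
    by (subst prod_eq) (use \<open>j \<noteq> k\<close> in \<open>auto simp: h_def M.prob_space\<close>)
  ultimately show "integrable (iid_power n M) (\<lambda>x. f (x j) * g (x k))"
    and "(\<integral>x. f (x j) * g (x k) \<partial>iid_power n M) = (\<integral>x. f x \<partial>M) * (\<integral>x. g x \<partial>M)"
    using h \<open>\<And>i. integrable M (h i)\<close> by (simp_all add: iid_power_def)
qed

text \<open>In the expanded double sum the off-diagonal terms factor by independence and vanish
  because f is centred, which leaves n equal diagonal terms. This yields both the covariance of
  normalised sums and the factor n in the Fisher metrics.\<close>

lemma integral_iid_sum_mult_sum:
  fixes f g :: "'a \<Rightarrow> real"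
  assumes M: "prob_space M" and f: "integrable M f" and g: "integrable M g"
    and fg: "integrable M (\<lambda>x. f x * g x)"
    and f0: "(\<integral>x. f x \<partial>M) = 0"
  shows "integrable (iid_power n M) (\<lambda>x. (\<Sum>j<n. f (x j)) * (\<Sum>j<n. g (x j)))"
    and "(\<integral>x. (\<Sum>j<n. f (x j)) * (\<Sum>j<n. g (x j)) \<partial>iid_power n M) = real n * (\<integral>x. f x * g x \<partial>M)"
proof -
  have int: "integrable (iid_power n M) (\<lambda>x. f (x j) * g (x k))"
    and val: "(\<integral>x. f (x j) * g (x k) \<partial>iid_power n M) = (if k = j then \<integral>x. f x * g x \<partial>M else 0)"
    if "j < n" "k < n" for j k
    using integral_iid_two_components[OF M that _ f g] f0 that
      integral_iid_component[OF M, where f = "\<lambda>x. f x * g x" and j = j and n = n] fg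
    by (cases "j = k"; auto)+
  show "integrable (iid_power n M) (\<lambda>x. (\<Sum>j<n. f (x j)) * (\<Sum>j<n. g (x j)))"
    unfolding sum_product by (intro Bochner_Integration.integrable_sum int) auto
  have "(\<integral>x. (\<Sum>j<n. f (x j)) * (\<Sum>j<n. g (x j)) \<partial>iid_power n M)
      = (\<Sum>j<n. \<Sum>k<n. \<integral>x. f (x j) * g (x k) \<partial>iid_power n M)"
    unfolding sum_product
    by (subst Bochner_Integration.integral_sum)
       (auto intro!: sum.cong Bochner_Integration.integral_sum Bochner_Integration.integrable_sum int)
  also have "\<dots> = real n * (\<integral>x. f x * g x \<partial>M)"
    by (simp add: val)
  finally show "(\<integral>x. (\<Sum>j<n. f (x j)) * (\<Sum>j<n. g (x j)) \<partial>iid_power n M) = real n * (\<integral>x. f x * g x \<partial>M)" .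
qed

text \<open>The scalar central limit theorem speaks of one independent sequence on one probability
  space, whereas \<open>iid_power n M\<close> changes with n. The sequence is realised on the
  infinite product, and restriction to \<open>{..<n}\<close> carries that measure to
  \<open>iid_power n M\<close>.\<close>

lemma iid_cos_tendsto:
  fixes f :: "'a \<Rightarrow> real"
  assumes M: "prob_space M" and [measurable]: "f \<in> borel_measurable M"
    and f2: "integrable M (\<lambda>x. (f x)\<^sup>2)" and mean: "(\<integral>x. f x \<partial>M) = 0"
    and var: "(\<integral>x. (f x)\<^sup>2 \<partial>M) = \<sigma>\<^sup>2" and \<sigma>: "\<sigma> > 0"
  shows "(\<lambda>n. \<integral>x. cos ((\<Sum>j<n. f (x j)) / sqrt n + s) \<partial>iid_power n M)
    \<longlonglongrightarrow> (\<integral>z. cos (\<sigma> * z + s) \<partial>std_normal_distribution)"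
proof -
  interpret M: prob_space M by fact
  interpret product_prob_space "\<lambda>_::nat. M" UNIV ..
  interpret P: prob_space "\<Pi>\<^sub>M i\<in>(UNIV::nat set). M" by (rule prob_space_PiM) (rule M)
  let ?\<Omega> = "\<Pi>\<^sub>M i\<in>(UNIV::nat set). M"
  have comp: "distr ?\<Omega> M (\<lambda>x. x i) = M" for i
    by (rule distr_PiM_component) (auto intro: M)
  have meas [measurable]: "(\<lambda>x. x i) \<in> ?\<Omega> \<rightarrow>\<^sub>M M" for i
    by (rule measurable_component_singleton) auto
  have "P.indep_vars (\<lambda>_. M) (\<lambda>i x. x i) UNIV"
    by (subst P.indep_vars_iff_distr_eq_PiM') (auto simp: comp restrict_UNIV)
  then have indep: "P.indep_vars (\<lambda>_. borel) (\<lambda>i x. f (x i)) UNIV"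
    by (rule P.indep_vars_compose2) auto
  have E: "(\<integral>x. h (x i) \<partial>?\<Omega>) = (\<integral>x. h x \<partial>M)" if "h \<in> borel_measurable M" for h :: "'a \<Rightarrow> real" and i
    using integral_distr[OF meas that, of i] unfolding comp ..
  have I: "integrable ?\<Omega> (\<lambda>x. h (x i)) \<longleftrightarrow> integrable M h" if "h \<in> borel_measurable M" for h :: "'a \<Rightarrow> real" and i
    using integrable_distr_eq[OF meas that, of i] unfolding comp ..
  have "weak_conv_m (\<lambda>n. distr ?\<Omega> borel (\<lambda>x. (\<Sum>i<n. f (x i)) / sqrt (n * \<sigma>\<^sup>2))) std_normal_distribution"
  proof (rule P.central_limit_theorem_zero_mean[OF indep])
    show "P.expectation (\<lambda>x. f (x n)) = 0" for n by (simp add: E mean)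
    show "integrable ?\<Omega> (\<lambda>x. (f (x n))\<^sup>2)" for n
      using f2 I[of "\<lambda>x. (f x)\<^sup>2" n] by simp
    show "P.variance (\<lambda>x. f (x n)) = \<sigma>\<^sup>2" for n
      using E[of "\<lambda>x. (f x)\<^sup>2" n] by (simp add: E mean var)
    show "distr ?\<Omega> borel (\<lambda>x. f (x n)) = distr M borel f" for n
      using distr_distr[of f M borel "\<lambda>x. x n" ?\<Omega>] by (simp add: comp comp_def)
  qed fact
  \<comment> \<open>The theorem normalises to unit variance; the test function cos(\<sigma> z + s)
    puts the scale \<sigma> back.\<close>
  then have "(\<lambda>n. \<integral>z. cos (\<sigma> * z + s) \<partial>distr ?\<Omega> borel (\<lambda>x. (\<Sum>i<n. f (x i)) / sqrt (n * \<sigma>\<^sup>2)))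
      \<longlonglongrightarrow> (\<integral>z. cos (\<sigma> * z + s) \<partial>std_normal_distribution)"
    by (intro weak_conv_imp_integral_bdd_continuous_conv[where B = 1])
       (auto intro!: real_distribution_distr real_dist_normal_dist)
  moreover have "(\<integral>z. cos (\<sigma> * z + s) \<partial>distr ?\<Omega> borel (\<lambda>x. (\<Sum>i<n. f (x i)) / sqrt (n * \<sigma>\<^sup>2)))
      = (\<integral>x. cos ((\<Sum>j<n. f (x j)) / sqrt n + s) \<partial>iid_power n M)" for n
  proof -
    have r: "distr ?\<Omega> (iid_power n M) (\<lambda>x. restrict x {..<n}) = iid_power n M"
      unfolding iid_power_def by (rule distr_PiM_restrict_finite) auto
    have [measurable]: "(\<lambda>x. x j) \<in> iid_power n M \<rightarrow>\<^sub>M M" if "j < n" for j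
      unfolding iid_power_def using that by (intro measurable_component_singleton) auto
    have "(\<integral>z. cos (\<sigma> * z + s) \<partial>distr ?\<Omega> borel (\<lambda>x. (\<Sum>i<n. f (x i)) / sqrt (n * \<sigma>\<^sup>2)))
        = (\<integral>x. cos (\<sigma> * ((\<Sum>i<n. f (x i)) / sqrt (n * \<sigma>\<^sup>2)) + s) \<partial>?\<Omega>)"
      by (subst integral_distr) auto
    also have "\<dots> = (\<integral>x. cos ((\<Sum>i<n. f (x i)) / sqrt n + s) \<partial>?\<Omega>)"
      using \<sigma> by (simp add: real_sqrt_mult field_simps)
    also have "\<dots> = (\<integral>x. cos ((\<Sum>i<n. f (x i)) / sqrt n + s) \<partial>distr ?\<Omega> (iid_power n M) (\<lambda>x. restrict x {..<n}))"
      by (subst integral_distr) (auto simp: iid_power_def intro!: measurable_restrict_subset)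
    finally show ?thesis unfolding r .
  qed
  ultimately show ?thesis by simp
qed

lemma prob_space_iid_power: "prob_space M \<Longrightarrow> prob_space (iid_power n M)"
  unfolding iid_power_def by (rule prob_space_PiM)

lemma measurable_iid_component [measurable (raw)]:
  "f \<in> M \<rightarrow>\<^sub>M N \<Longrightarrow> j < n \<Longrightarrow> (\<lambda>x. f (x j)) \<in> iid_power n M \<rightarrow>\<^sub>M N"
  unfolding iid_power_def by (rule measurable_compose[OF measurable_component_singleton]) auto

lemma measurable_iid_sum:
  fixes f :: "'a \<Rightarrow> 'b::{second_countable_topology, real_normed_vector}"
  assumes "f \<in> borel_measurable M"
  shows "(\<lambda>x. \<Sum>j<n. f (x j)) \<in> borel_measurable (iid_power n M)"
  using assms by (intro borel_measurable_sum measurable_iid_component) auto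

text \<open>Continuity from above: the tail sets decrease to the empty set. The eventual form lets
  the radius be enlarged to meet a second condition at the same time.\<close>

lemma borel_prob_tight:
  assumes "borel_prob (Q :: (real^'d) measure)" "e > 0"
  shows "\<forall>\<^sub>F k in sequentially. measure Q {x. \<exists>i. \<bar>x $ i\<bar> > real k} \<le> e"
proof -
  interpret prob_space Q using assms by (simp add: borel_prob_def)
  have [measurable_cong, simp]: "sets Q = sets borel" using assms by (simp add: borel_prob_def)
  let ?A = "\<lambda>k. {x::real^'d. \<exists>i. \<bar>x $ i\<bar> > real k}"
  have "(\<Inter>k. ?A k) = {}"
  proof safe
    fix x :: "real^'d" assume x: "x \<in> (\<Inter>k. ?A k)"
    obtain k :: nat where k: "norm x \<le> real k" using real_arch_simple by blast
    from x obtain i where "\<bar>x $ i\<bar> > real k" by auto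
    with k component_le_norm_cart[of x i] show "x \<in> {}" by simp
  qed
  moreover have "(\<lambda>k. measure Q (?A k)) \<longlonglongrightarrow> measure Q (\<Inter>k. ?A k)"
  proof (rule finite_Lim_measure_decseq)
    show "range ?A \<subseteq> sets Q" by auto
    show "decseq ?A"
      unfolding decseq_def by (intro allI impI Collect_mono) (metis le_less_trans of_nat_mono)
  qed
  ultimately have "(\<lambda>k. measure Q (?A k)) \<longlonglongrightarrow> 0" by simp
  from order_tendstoD(2)[OF this assms(2)] show ?thesis
    by (rule eventually_mono) simp
qed

section \<open>Normalised sums of a centred sample with identity covariance\<close>

text \<open>Moments are prescribed for all functionals u . X rather than for coordinates, since the
  limit theorem is applied to projections; \<open>cov_X\<close> says that the covariance matrix is
  the identity.\<close>

locale standardized_sample =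
  fixes M :: "'a measure" and X :: "'a \<Rightarrow> real^'d"
  assumes prob: "prob_space M"
    and measurable_X [measurable]: "X \<in> borel_measurable M"
    and integrable_X: "\<And>u. integrable M (\<lambda>x. u \<bullet> X x)"
    and mean_X: "\<And>u. (\<integral>x. u \<bullet> X x \<partial>M) = 0"
    and integrable_XX: "\<And>u v. integrable M (\<lambda>x. (u \<bullet> X x) * (v \<bullet> X x))"
    and cov_X: "\<And>u v. (\<integral>x. (u \<bullet> X x) * (v \<bullet> X x) \<partial>M) = u \<bullet> v"
begin

definition normed_sum :: "nat \<Rightarrow> (nat \<Rightarrow> 'a) \<Rightarrow> real^'d" where
  "normed_sum n x = (1 / sqrt n) *\<^sub>R (\<Sum>j<n. X (x j))"

definition law :: "nat \<Rightarrow> (real^'d) measure" where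
  "law n = distr (iid_power n M) borel (normed_sum n)"

lemma measurable_normed_sum [measurable]: "normed_sum n \<in> borel_measurable (iid_power n M)"
  unfolding normed_sum_def using measurable_iid_sum[OF measurable_X] by measurable

lemma borel_prob_law: "borel_prob (law n)"
proof -
  interpret prob_space "iid_power n M" by (rule prob_space_iid_power[OF prob])
  show ?thesis
    unfolding borel_prob_def law_def by (auto intro!: prob_space_distr)
qed

lemma sets_law [simp, measurable_cong]: "sets (law n) = sets borel"
  by (simp add: law_def)

lemma inner_normed_sum: "u \<bullet> normed_sum n x = (1 / sqrt n) * (\<Sum>j<n. u \<bullet> X (x j))"
  by (simp add: normed_sum_def inner_sum_right)

text \<open>The two factors 1 / sqrt n cancel the n diagonal terms. At n = 0 the law is the point
  mass at 0, whence the condition on n.\<close>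

lemma law_second_moments:
  assumes "n \<ge> 1"
  shows "integrable (law n) (\<lambda>y. (u \<bullet> y) * (v \<bullet> y))"
    and "(\<integral>y. (u \<bullet> y) * (v \<bullet> y) \<partial>law n) = u \<bullet> v"
proof -
  have eq: "(u \<bullet> normed_sum n x) * (v \<bullet> normed_sum n x)
      = (1 / n) * ((\<Sum>j<n. u \<bullet> X (x j)) * (\<Sum>j<n. v \<bullet> X (x j)))" for x
    unfolding inner_normed_sum by simp
  note * = integral_iid_sum_mult_sum[OF prob integrable_X integrable_X integrable_XX mean_X, of n u v]
  show "integrable (law n) (\<lambda>y. (u \<bullet> y) * (v \<bullet> y))"
    unfolding law_def by (subst integrable_distr_eq) (use * in \<open>auto simp: eq\<close>)
  show "(\<integral>y. (u \<bullet> y) * (v \<bullet> y) \<partial>law n) = u \<bullet> v"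
    unfolding law_def using assms * by (subst integral_distr) (auto simp: eq cov_X)
qed

lemma law_first_moments:
  shows "integrable (law n) (\<lambda>y. u \<bullet> y)" and "(\<integral>y. u \<bullet> y \<partial>law n) = 0"
proof -
  have int: "integrable (iid_power n M) (\<lambda>x. u \<bullet> X (x j))"
    and val: "(\<integral>x. u \<bullet> X (x j) \<partial>iid_power n M) = 0" if "j < n" for j
    using integral_iid_component[OF prob that, of "\<lambda>x. u \<bullet> X x"] integrable_X[of u] mean_X[of u] by auto
  show "integrable (law n) (\<lambda>y. u \<bullet> y)"
    unfolding law_def
    by (subst integrable_distr_eq) (auto simp: inner_normed_sum intro!: Bochner_Integration.integrable_sum int)
  have "(\<integral>y. u \<bullet> y \<partial>law n) = (1 / sqrt n) * (\<integral>x. (\<Sum>j<n. u \<bullet> X (x j)) \<partial>iid_power n M)"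
    unfolding law_def by (subst integral_distr) (auto simp: inner_normed_sum)
  also have "(\<integral>x. (\<Sum>j<n. u \<bullet> X (x j)) \<partial>iid_power n M) = 0"
    by (subst Bochner_Integration.integral_sum) (auto simp: int val)
  finally show "(\<integral>y. u \<bullet> y \<partial>law n) = 0" by simp
qed

lemma has_mean_covariance_law:
  assumes "n \<ge> 1"
  shows "has_mean_covariance (law n) 0 (mat 1)"
proof -
  have int: "integrable (law n) (\<lambda>y. y)"
  proof -
    have "(\<lambda>y::real^'d. \<Sum>b\<in>Basis. (b \<bullet> y) *\<^sub>R b) = (\<lambda>y. y)"
      by (auto simp: fun_eq_iff inner_commute euclidean_representation)
    moreover have "integrable (law n) (\<lambda>y. \<Sum>b\<in>Basis. (b \<bullet> y) *\<^sub>R b)"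
      by (intro Bochner_Integration.integrable_sum integrable_scaleR_left law_first_moments)
    ultimately show ?thesis by simp
  qed
  have "u \<bullet> (\<integral>y. y \<partial>law n) = 0" for u
    using law_first_moments(2)[of n u] integral_inner_right[of u "law n" "\<lambda>y. y"] int by simp
  then have "(\<integral>y. y \<partial>law n) = 0"
    by (metis inner_eq_zero_iff)
  moreover have "x $ i = axis i 1 \<bullet> x" for x :: "real^'d" and i
    by (simp add: inner_axis')
  moreover have "axis i 1 \<bullet> axis j (1::real) = (mat 1 :: real^'d^'d) $ i $ j" for i j
    by (auto simp: inner_axis_axis mat_def)
  ultimately show ?thesis
    unfolding has_mean_covariance_def has_mean_def
    using int law_second_moments[OF assms, of "axis _ 1" "axis _ 1"] by simp
qed

text \<open>Each coordinate has second moment 1, so Markov's inequality for its square gives 1 /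
  R^2, and a union bound sums over the coordinates. The bound is the same for all n.\<close>

lemma law_tight:
  assumes "n \<ge> 1" "R > 0"
  shows "measure (law n) {x. \<exists>i. \<bar>x $ i\<bar> > R} \<le> CARD('d) / R\<^sup>2"
proof -
  interpret prob_space "law n" using borel_prob_law by (simp add: borel_prob_def)
  have [simp]: "space (law n) = UNIV" by (simp add: law_def)
  have m: "{x::real^'d. \<bar>x $ i\<bar> > R} \<in> sets (law n)" for i
    by simp
  have "{x. \<exists>i. \<bar>x $ i\<bar> > R} = (\<Union>i\<in>UNIV. {x::real^'d. \<bar>x $ i\<bar> > R})"
    by auto
  then have "measure (law n) {x. \<exists>i. \<bar>x $ i\<bar> > R} \<le> (\<Sum>i\<in>UNIV. measure (law n) {x::real^'d. \<bar>x $ i\<bar> > R})"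
    using finite_measure_subadditive_finite[of UNIV "\<lambda>i. {x::real^'d. \<bar>x $ i\<bar> > R}"] m
    by (simp add: image_subset_iff)
  also have "\<dots> \<le> (\<Sum>i\<in>(UNIV :: 'd set). 1 / R\<^sup>2)"
  proof (rule sum_mono)
    fix i :: 'd
    have *: "integrable (law n) (\<lambda>y. (y $ i)\<^sup>2)" "(\<integral>y. (y $ i)\<^sup>2 \<partial>law n) = 1"
      using law_second_moments[OF assms(1), of "axis i 1" "axis i 1"]
      by (auto simp: inner_axis' power2_eq_square inner_axis_axis)
    have "measure (law n) {x::real^'d. \<bar>x $ i\<bar> > R} \<le> measure (law n) {x \<in> space (law n). (x $ i)\<^sup>2 \<ge> R\<^sup>2}"
    proof (rule finite_measure_mono)
      show "{x::real^'d. \<bar>x $ i\<bar> > R} \<subseteq> {x \<in> space (law n). (x $ i)\<^sup>2 \<ge> R\<^sup>2}"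
        using assms by (auto simp: abs_le_square_iff[symmetric])
    qed simp
    also have "\<dots> \<le> (\<integral>y. (y $ i)\<^sup>2 \<partial>law n) / R\<^sup>2"
      using assms by (intro integral_Markov_inequality_measure[where A = "{}"] *) auto
    finally show "measure (law n) {x::real^'d. \<bar>x $ i\<bar> > R} \<le> 1 / R\<^sup>2"
      using * by simp
  qed
  also have "\<dots> = CARD('d) / R\<^sup>2" by simp
  finally show ?thesis .
qed

text \<open>Cramer-Wold argument: t . X is centred with variance t . t, so the scalar theorem with
  \<sigma> = \<open>norm t\<close> gives the limit of every cosine integral, and the standard normal
  measure assigns the same value to that cosine.\<close>

theorem law_converges_weakly: "converges_weakly law std_normal_measure"
proof (rule converges_weaklyI_trig)
  show Q: "borel_prob (std_normal_measure :: (real^'d) measure)"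
    by (simp add: borel_prob_def prob_space_std_normal_measure)
  show "borel_prob (law n)" for n by (rule borel_prob_law)
  show "(\<lambda>n. \<integral>x. cos (t \<bullet> x + s) \<partial>law n) \<longlonglongrightarrow> (\<integral>x. cos (t \<bullet> x + s) \<partial>std_normal_measure)" for t s
  \<comment> \<open>The scalar theorem requires positive variance, so the degenerate projection is
    treated apart; there both integrals equal cos s.\<close>
  proof (cases "t = 0")
    case True
    have "prob_space (law n)" for n using borel_prob_law by (simp add: borel_prob_def)
    then show ?thesis
      using True prob_space.prob_space[OF prob_space_std_normal_measure[where 'd = 'd]]
      by (simp add: prob_space.prob_space)
  next
    case False
    have "(\<integral>x. cos (t \<bullet> x + s) \<partial>law n) = (\<integral>x. cos ((\<Sum>j<n. t \<bullet> X (x j)) / sqrt n + s) \<partial>iid_power n M)" for n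
      unfolding law_def by (subst integral_distr) (auto simp: inner_normed_sum)
    moreover have "(\<lambda>n. \<integral>x. cos ((\<Sum>j<n. t \<bullet> X (x j)) / sqrt n + s) \<partial>iid_power n M)
      \<longlonglongrightarrow> (\<integral>z. cos (norm t * z + s) \<partial>std_normal_distribution)"
      using False integrable_XX[of t t] cov_X[of t t]
      by (intro iid_cos_tendsto prob) (auto simp: mean_X power2_eq_square dot_square_norm)
    ultimately show ?thesis
      by (simp add: integral_cos_std_normal_measure)
  qed
  fix e :: real assume e: "e > 0"
  have "\<forall>\<^sub>F k in sequentially. CARD('d) / (real k)\<^sup>2 < e"
    using e by (intro order_tendstoD(2)[where y = 0]) (auto intro!: tendsto_divide_0[OF tendsto_const]
        filterlim_at_top_imp_at_infinity filterlim_pow_at_top filterlim_real_sequentially)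
  \<comment> \<open>One integer radius has to serve all the laws, through the second-moment bound,
    and the limit, through tightness of a single measure.\<close>
  then have "\<forall>\<^sub>F k in sequentially. CARD('d) / (real k)\<^sup>2 < e \<and> k > 0
      \<and> measure (std_normal_measure :: (real^'d) measure) {x. \<exists>i. \<bar>x $ i\<bar> > real k} \<le> e"
    using borel_prob_tight[OF Q e] eventually_gt_at_top by eventually_elim auto
  then obtain k :: nat where k: "CARD('d) / (real k)\<^sup>2 < e" "k > 0"
      "measure (std_normal_measure :: (real^'d) measure) {x. \<exists>i. \<bar>x $ i\<bar> > real k} \<le> e"
    by (auto simp: eventually_sequentially)
  then show "\<exists>R>0. (\<forall>n\<ge>1. measure (law n) {x. \<exists>i. \<bar>x $ i\<bar> > R} \<le> e) \<and>
      measure (std_normal_measure :: (real^'d) measure) {x. \<exists>i. \<bar>x $ i\<bar> > R} \<le> e"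
    using law_tight[of _ "real k"] by (intro exI[of _ "real k"]) fastforce
qed

end

section \<open>Regular exponential families\<close>

text \<open>Second-order Taylor remainder with an explicit majorant; it dominates the difference
  quotients of the partition function.\<close>

lemma exp_minus_1_minus_bound:
  fixes y :: real
  shows "\<bar>exp y - 1 - y\<bar> \<le> y\<^sup>2 * exp \<bar>y\<bar>"
proof -
  have "(\<Sum>i\<le>1. y ^ i / fact i) = 1 + y"
    by (simp add: atMost_Suc)
  then show ?thesis
    using Taylor_exp_field[of y 1] by (simp add: power2_eq_square diff_diff_eq mult.commute)
qed

text \<open>The quadratic Taylor term of \<open>exp\<close> shows that an arbitrarily small
  exponential weight absorbs a square. Exponential moments thereby give second moments.\<close>

lemma square_le_exp:
  fixes s \<delta> :: real
  assumes "\<delta> > 0"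
  shows "s\<^sup>2 \<le> 2 / \<delta>\<^sup>2 * exp (\<delta> * \<bar>s\<bar>)"
proof -
  have "(\<delta> * \<bar>s\<bar>)\<^sup>2 / 2 \<le> exp (\<delta> * \<bar>s\<bar>)"
    using exp_lower_Taylor_quadratic[of "\<delta> * \<bar>s\<bar>"] assms by (smt (verit) mult_nonneg_nonneg abs_ge_zero)
  then show ?thesis
    using assms by (simp add: power_mult_distrib field_simps)
qed

section \<open>Signed measures with densities\<close>

text \<open>Moves a density from the dominating measure to the model measure, so that a tangent
  vector becomes its score times its base-point.\<close>

lemma signed_density_density:
  assumes [measurable]: "p \<in> borel_measurable M" "h \<in> borel_measurable M" and "\<And>x. 0 \<le> p x"
  shows "signed_density (density M (\<lambda>x. ennreal (p x))) h = signed_density M (\<lambda>x. h x * p x)"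
proof
  fix U
  show "signed_density (density M (\<lambda>x. ennreal (p x))) h U = signed_density M (\<lambda>x. h x * p x) U"
  proof (cases "U \<in> sets M")
    case True
    then have [measurable]: "U \<in> sets M" .
    have "(LINT x:U|density M (\<lambda>x. ennreal (p x)). h x) = (LINT x:U|M. h x * p x)"
      unfolding set_lebesgue_integral_def
      by (subst integral_density) (auto simp: assms mult_ac)
    then show ?thesis by (simp add: signed_density_def)
  qed (simp add: signed_density_def)
qed

lemma signed_density_comb:
  assumes "integrable M f" "integrable M g"
  shows "signed_density M (\<lambda>x. s * f x + t * g x) = (\<lambda>U. s * signed_density M f U + t * signed_density M g U)"
proof
  fix U
  show "signed_density M (\<lambda>x. s * f x + t * g x) U = s * signed_density M f U + t * signed_density M g U"
  proof (cases "U \<in> sets M")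
    case True
    then have "set_integrable M U (\<lambda>x. s * f x)" "set_integrable M U (\<lambda>x. t * g x)"
      using assms unfolding set_integrable_def
      by (auto intro!: integrable_mult_indicator[where 'b = real, simplified] integrable_mult_right)
    with True show ?thesis
      by (simp add: signed_density_def set_integral_add)
  qed (simp add: signed_density_def)
qed

lemma signed_density_AE_zero:
  assumes "AE x in M. f x = 0"
  shows "signed_density M f = (\<lambda>_. 0)"
proof
  fix U
  have "(LINT x:U|M. f x) = 0"
    unfolding set_lebesgue_integral_def using assms
    by (intro integral_eq_zero_AE) auto
  then show "signed_density M f U = 0" by (simp add: signed_density_def)
qed

text \<open>\<open>signed_RN_deriv\<close> is an arbitrary choice among the integrable densities.
  These agree almost everywhere, so the integral does not depend on the choice and can be computed
  from any known f and g.\<close>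

lemma fisher_metric_signed_density:
  fixes f g :: "'a \<Rightarrow> real"
  assumes f: "integrable P f" and g: "integrable P g"
  shows "fisher_metric (P, signed_density P f) (P, signed_density P g) = (\<integral>x. f x * g x \<partial>P)"
proof -
  have RN: "integrable P (signed_RN_deriv P (signed_density P f)) \<and> (AE x in P. signed_RN_deriv P (signed_density P f) x = f x)"
    if f: "integrable P f" for f :: "'a \<Rightarrow> real"
  proof -
    define h where "h = signed_RN_deriv P (signed_density P f)"
    have h: "integrable P h \<and> signed_density P f = signed_density P h"
      unfolding h_def signed_RN_deriv_def by (rule someI[of _ f]) (use f in simp)
    have "(LINT x:A|P. h x) = (LINT x:A|P. f x)" if "A \<in> sets P" for A
    proof -
      have "signed_density P h A = signed_density P f A" using h by simp
      then show ?thesis using that by (simp add: signed_density_def)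
    qed
    then have "AE x in P. h x = f x"
      using h f by (intro density_unique_real) auto
    with h show ?thesis by (simp add: h_def)
  qed
  show ?thesis
    unfolding fisher_metric_def fst_conv snd_conv
  proof (rule integral_cong_AE)
    show "AE x in P. signed_RN_deriv P (signed_density P f) x * signed_RN_deriv P (signed_density P g) x = f x * g x"
      using RN[OF f, THEN conjunct2] RN[OF g, THEN conjunct2] by eventually_elim simp
    show "(\<lambda>x. signed_RN_deriv P (signed_density P f) x * signed_RN_deriv P (signed_density P g) x) \<in> borel_measurable P"
      "(\<lambda>x. f x * g x) \<in> borel_measurable P"
      using RN[OF f] RN[OF g] f g by (auto intro: borel_measurable_times)
  qed
qed

text \<open>Change of variables for a density that factors through \<phi>. Affine images of tangent
  vectors to the natural families are computed with it.\<close>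

lemma signed_distr_signed_density:
  assumes [measurable]: "\<phi> \<in> M \<rightarrow>\<^sub>M N" "f \<in> borel_measurable N"
  shows "signed_distr M N \<phi> (signed_density M (\<lambda>x. f (\<phi> x))) = signed_density (distr M N \<phi>) f"
proof
  fix U
  show "signed_distr M N \<phi> (signed_density M (\<lambda>x. f (\<phi> x))) U = signed_density (distr M N \<phi>) f U"
  proof (cases "U \<in> sets N")
    case True
    then have [measurable]: "U \<in> sets N" .
    have U: "\<phi> -` U \<inter> space M \<in> sets M" by measurable
    have "(LINT x:\<phi> -` U \<inter> space M|M. f (\<phi> x)) = (LINT x:U|distr M N \<phi>. f x)"
      unfolding set_lebesgue_integral_def
      by (subst integral_distr) (auto intro!: Bochner_Integration.integral_cong simp: indicator_def)
    with True U show ?thesis by (simp add: signed_distr_def signed_density_def)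
  qed (simp add: signed_distr_def signed_density_def)
qed

section \<open>Exponential moments and the derivative of the partition function\<close>

context regular_exponential_family
begin

abbreviation D where "D \<equiv> dominating \<mu>"
abbreviation Z where "Z \<equiv> partition_fun \<mu> T"
abbreviation \<Theta> where "\<Theta> \<equiv> param_space \<mu> T"
abbreviation P where "P \<equiv> ef_measure \<mu> T"

lemma T_measurable [measurable]: "T \<in> borel_measurable D"
  by (rule measurable_T)

lemma integrable_exp: "\<theta> \<in> \<Theta> \<Longrightarrow> integrable D (\<lambda>x. exp (\<theta> \<bullet> T x))"
  by (auto simp: integrable_iff_bounded param_space_def)

text \<open>Over a null dominating measure every tangent vector would vanish, against
  \<open>immersion\<close>; \<open>axis undefined 1\<close> is just some non-zero direction.
  Positivity of \<open>Z\<close> rests on this.\<close>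

lemma AE_D_nontrivial: "\<not> (AE x in D. False)"
proof
  assume AE: "AE x in D. False"
  obtain \<theta> where \<theta>: "\<theta> \<in> \<Theta>" using param_space_nonempty by blast
  have "snd (ef_tangent \<mu> T \<theta> (axis undefined 1)) = (\<lambda>_. 0)"
    unfolding ef_tangent_def snd_conv using AE by (intro signed_density_AE_zero) auto
  moreover have "axis undefined 1 \<noteq> (0 :: real^'d)"
    by (metis axis_eq_0_iff zero_neq_one)
  ultimately show False using immersion \<theta> by blast
qed

lemma Z_pos:
  assumes "\<theta> \<in> \<Theta>"
  shows "Z \<theta> > 0"
proof -
  have "Z \<theta> \<noteq> 0"
    using integral_nonneg_eq_0_iff_AE[OF integrable_exp[OF assms]] AE_D_nontrivial
    by (simp add: partition_fun_def)
  moreover have "Z \<theta> \<ge> 0" by (simp add: partition_fun_def)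
  ultimately show ?thesis by simp
qed

text \<open>Openness of \<Theta> places both \<theta> + \<delta> u and \<theta> - \<delta> u in it,
  and exp(\<delta> |s|) is at most exp(\<delta> s) + exp(-\<delta> s).\<close>

lemma integrable_exp_abs:
  assumes "\<theta> \<in> \<Theta>"
  obtains \<delta> where "\<delta> > 0" "integrable D (\<lambda>x. exp (\<delta> * \<bar>u \<bullet> T x\<bar>) * exp (\<theta> \<bullet> T x))"
proof -
  obtain e where e: "e > 0" "ball \<theta> e \<subseteq> \<Theta>"
    using param_space_open assms open_contains_ball by blast
  \<comment> \<open>The summand 1 keeps the denominator positive when u = 0, and the final half
    makes the norm of \<delta> u strictly less than e.\<close>
  define \<delta> where "\<delta> = e / (norm u + 1) / 2"
  have \<delta>: "\<delta> > 0" using e by (simp add: \<delta>_def add_nonneg_pos)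
  have "norm (\<delta> *\<^sub>R u) < e"
  proof -
    have "norm (\<delta> *\<^sub>R u) = e / 2 * (norm u / (norm u + 1))"
      using \<delta> e by (simp add: \<delta>_def)
    also have "\<dots> \<le> e / 2 * 1"
      using e by (intro mult_left_mono) (auto simp: divide_le_eq_1 add_nonneg_pos)
    finally show ?thesis using e by simp
  qed
  then have "\<theta> + \<delta> *\<^sub>R u \<in> \<Theta>" "\<theta> - \<delta> *\<^sub>R u \<in> \<Theta>"
    using e by (auto simp: subset_iff dist_norm)
  then have "integrable D (\<lambda>x. exp ((\<theta> + \<delta> *\<^sub>R u) \<bullet> T x) + exp ((\<theta> - \<delta> *\<^sub>R u) \<bullet> T x))"
    by (intro Bochner_Integration.integrable_add integrable_exp)
  then have "integrable D (\<lambda>x. exp (\<delta> * \<bar>u \<bullet> T x\<bar>) * exp (\<theta> \<bullet> T x))"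
  proof (rule Bochner_Integration.integrable_bound)
    have "exp (\<delta> * \<bar>u \<bullet> T x\<bar>) * exp (\<theta> \<bullet> T x) \<le> exp ((\<theta> + \<delta> *\<^sub>R u) \<bullet> T x) + exp ((\<theta> - \<delta> *\<^sub>R u) \<bullet> T x)" for x
      by (cases "u \<bullet> T x \<ge> 0") (simp_all add: inner_add_left inner_diff_left exp_add[symmetric] add_ac)
    then show "AE x in D. norm (exp (\<delta> * \<bar>u \<bullet> T x\<bar>) * exp (\<theta> \<bullet> T x))
        \<le> norm (exp ((\<theta> + \<delta> *\<^sub>R u) \<bullet> T x) + exp ((\<theta> - \<delta> *\<^sub>R u) \<bullet> T x))"
      by (auto intro!: AE_I2)
  qed measurable
  with \<delta> show ?thesis by (rule that)
qed

lemma integrable_square_exp: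
  assumes "\<theta> \<in> \<Theta>"
  shows "integrable D (\<lambda>x. (u \<bullet> T x)\<^sup>2 * exp (\<theta> \<bullet> T x))"
proof -
  obtain \<delta> where \<delta>: "\<delta> > 0" "integrable D (\<lambda>x. exp (\<delta> * \<bar>u \<bullet> T x\<bar>) * exp (\<theta> \<bullet> T x))"
    using integrable_exp_abs[OF assms] by metis
  then have "integrable D (\<lambda>x. 2 / \<delta>\<^sup>2 * (exp (\<delta> * \<bar>u \<bullet> T x\<bar>) * exp (\<theta> \<bullet> T x)))"
    by simp
  then show ?thesis
  proof (rule Bochner_Integration.integrable_bound)
    show "AE x in D. norm ((u \<bullet> T x)\<^sup>2 * exp (\<theta> \<bullet> T x)) \<le> norm (2 / \<delta>\<^sup>2 * (exp (\<delta> * \<bar>u \<bullet> T x\<bar>) * exp (\<theta> \<bullet> T x)))"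
    proof (rule AE_I2)
      fix x
      have "(u \<bullet> T x)\<^sup>2 * exp (\<theta> \<bullet> T x) \<le> (2 / \<delta>\<^sup>2 * exp (\<delta> * \<bar>u \<bullet> T x\<bar>)) * exp (\<theta> \<bullet> T x)"
        by (intro mult_right_mono square_le_exp \<delta>) auto
      then show "norm ((u \<bullet> T x)\<^sup>2 * exp (\<theta> \<bullet> T x)) \<le> norm (2 / \<delta>\<^sup>2 * (exp (\<delta> * \<bar>u \<bullet> T x\<bar>) * exp (\<theta> \<bullet> T x)))"
        by (simp add: abs_mult mult.assoc)
    qed
  qed measurable
qed

lemma integrable_linear_exp:
  assumes "\<theta> \<in> \<Theta>"
  shows "integrable D (\<lambda>x. (u \<bullet> T x) * exp (\<theta> \<bullet> T x))"
proof -
  have "integrable D (\<lambda>x. (u \<bullet> T x)\<^sup>2 * exp (\<theta> \<bullet> T x) + exp (\<theta> \<bullet> T x))"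
    using assms by (intro Bochner_Integration.integrable_add integrable_square_exp integrable_exp)
  then show ?thesis
  proof (rule Bochner_Integration.integrable_bound)
    show "AE x in D. norm ((u \<bullet> T x) * exp (\<theta> \<bullet> T x)) \<le> norm ((u \<bullet> T x)\<^sup>2 * exp (\<theta> \<bullet> T x) + exp (\<theta> \<bullet> T x))"
    proof (rule AE_I2)
      fix x
      have "\<bar>s\<bar> \<le> s\<^sup>2 + 1" for s :: real
        using zero_le_power2[of "\<bar>s\<bar> - 1"] by (simp add: power2_diff)
      then have "\<bar>u \<bullet> T x\<bar> * exp (\<theta> \<bullet> T x) \<le> ((u \<bullet> T x)\<^sup>2 + 1) * exp (\<theta> \<bullet> T x)"
        by (intro mult_right_mono) auto
      also have "\<dots> = norm ((u \<bullet> T x)\<^sup>2 * exp (\<theta> \<bullet> T x) + exp (\<theta> \<bullet> T x))"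
        by (simp add: ring_distribs)
      finally show "norm ((u \<bullet> T x) * exp (\<theta> \<bullet> T x)) \<le> norm ((u \<bullet> T x)\<^sup>2 * exp (\<theta> \<bullet> T x) + exp (\<theta> \<bullet> T x))"
        by (simp add: abs_mult)
    qed
  qed measurable
qed

lemma integrable_mult_exp:
  assumes "\<theta> \<in> \<Theta>"
  shows "integrable D (\<lambda>x. ((u \<bullet> T x) * (v \<bullet> T x)) * exp (\<theta> \<bullet> T x))"
proof -
  have "(u \<bullet> T x) * (v \<bullet> T x) * exp (\<theta> \<bullet> T x)
      = ((u + v) \<bullet> T x)\<^sup>2 * exp (\<theta> \<bullet> T x) / 4 - ((u - v) \<bullet> T x)\<^sup>2 * exp (\<theta> \<bullet> T x) / 4" for x
    by (simp add: inner_add_left inner_diff_left power2_eq_square field_simps)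
  moreover have "integrable D (\<lambda>x. ((u + v) \<bullet> T x)\<^sup>2 * exp (\<theta> \<bullet> T x) / 4 - ((u - v) \<bullet> T x)\<^sup>2 * exp (\<theta> \<bullet> T x) / 4)"
    using assms by (intro Bochner_Integration.integrable_diff integrable_divide integrable_square_exp)
  ultimately show ?thesis by simp
qed

text \<open>Differentiation under the integral by a direct remainder estimate: near t = 0 the
  integrand differs from its linearisation by at most t^2 times a fixed integrable function, so the
  difference quotient is within |t| K of its limit.\<close>

lemma partition_fun_has_derivative:
  assumes \<theta>: "\<theta> \<in> \<Theta>"
  shows "((\<lambda>t. Z (\<theta> + t *\<^sub>R u)) has_real_derivative (\<integral>x. (u \<bullet> T x) * exp (\<theta> \<bullet> T x) \<partial>D)) (at 0)"
proof -
  obtain \<delta> where \<delta>: "\<delta> > 0" and int: "integrable D (\<lambda>x. exp (\<delta> * \<bar>u \<bullet> T x\<bar>) * exp (\<theta> \<bullet> T x))"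
    using integrable_exp_abs[OF \<theta>] by metis
  define m where "m = (\<integral>x. (u \<bullet> T x) * exp (\<theta> \<bullet> T x) \<partial>D)"
  \<comment> \<open>The exponent \<delta> is spent in two halves: one bounds exp |t s| for |t| \<le>
    \<delta>/2, the other absorbs s^2 through \<open>square_le_exp\<close>, whence the constant 2 /
    (\<delta>/2)^2.\<close>
  define K where "K = (\<integral>x. 2 / (\<delta> / 2)\<^sup>2 * (exp (\<delta> * \<bar>u \<bullet> T x\<bar>) * exp (\<theta> \<bullet> T x)) \<partial>D)"
  have bound: "\<bar>Z (\<theta> + t *\<^sub>R u) - Z \<theta> - t * m\<bar> \<le> t\<^sup>2 * K" if t: "\<bar>t\<bar> \<le> \<delta> / 2" for t
  proof -
    have ts: "\<bar>t * s\<bar> \<le> \<delta> / 2 * \<bar>s\<bar>" for s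
      unfolding abs_mult using t by (rule mult_right_mono) simp
    have int_t: "integrable D (\<lambda>x. exp ((\<theta> + t *\<^sub>R u) \<bullet> T x))"
      using int
    proof (rule Bochner_Integration.integrable_bound)
      have "t * s \<le> \<delta> * \<bar>s\<bar>" for s
      proof -
        have "t * s \<le> \<delta> / 2 * \<bar>s\<bar>" using ts[of s] by linarith
        also have "\<dots> \<le> \<delta> * \<bar>s\<bar>" using \<delta> by (intro mult_right_mono) auto
        finally show ?thesis .
      qed
      then show "AE x in D. norm (exp ((\<theta> + t *\<^sub>R u) \<bullet> T x)) \<le> norm (exp (\<delta> * \<bar>u \<bullet> T x\<bar>) * exp (\<theta> \<bullet> T x))"
        by (auto simp: inner_add_left exp_add[symmetric])
    qed measurable
    have "Z (\<theta> + t *\<^sub>R u) - Z \<theta> - t * m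
        = (\<integral>x. exp ((\<theta> + t *\<^sub>R u) \<bullet> T x) - exp (\<theta> \<bullet> T x) - t * ((u \<bullet> T x) * exp (\<theta> \<bullet> T x)) \<partial>D)"
      using int_t integrable_exp[OF \<theta>] integrable_linear_exp[OF \<theta>, of u]
      by (simp add: m_def partition_fun_def)
    also have "\<bar>\<dots>\<bar> \<le> (\<integral>x. t\<^sup>2 * (2 / (\<delta> / 2)\<^sup>2 * (exp (\<delta> * \<bar>u \<bullet> T x\<bar>) * exp (\<theta> \<bullet> T x))) \<partial>D)"
    proof (rule integral_abs_bound_integral)
      show "integrable D (\<lambda>x. exp ((\<theta> + t *\<^sub>R u) \<bullet> T x) - exp (\<theta> \<bullet> T x) - t * ((u \<bullet> T x) * exp (\<theta> \<bullet> T x)))"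
        using int_t integrable_exp[OF \<theta>] integrable_linear_exp[OF \<theta>, of u] by auto
      show "integrable D (\<lambda>x. t\<^sup>2 * (2 / (\<delta> / 2)\<^sup>2 * (exp (\<delta> * \<bar>u \<bullet> T x\<bar>) * exp (\<theta> \<bullet> T x))))"
        using int by simp
      fix x
      define s where "s = u \<bullet> T x"
      have "\<bar>exp (t * s) - 1 - t * s\<bar> \<le> (t * s)\<^sup>2 * exp \<bar>t * s\<bar>"
        by (rule exp_minus_1_minus_bound)
      also have "\<dots> \<le> (t * s)\<^sup>2 * exp (\<delta> / 2 * \<bar>s\<bar>)"
        using ts by (intro mult_left_mono) auto
      also have "\<dots> = t\<^sup>2 * (s\<^sup>2 * exp (\<delta> / 2 * \<bar>s\<bar>))"
        by (simp add: power_mult_distrib)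
      also have "\<dots> \<le> t\<^sup>2 * ((2 / (\<delta> / 2)\<^sup>2 * exp (\<delta> / 2 * \<bar>s\<bar>)) * exp (\<delta> / 2 * \<bar>s\<bar>))"
        using \<delta> by (intro mult_left_mono mult_right_mono square_le_exp) auto
      also have "\<dots> = t\<^sup>2 * (2 / (\<delta> / 2)\<^sup>2 * exp (\<delta> * \<bar>s\<bar>))"
        by (simp add: exp_add[symmetric] mult.assoc)
      finally have "\<bar>exp (t * s) - 1 - t * s\<bar> * exp (\<theta> \<bullet> T x) \<le> t\<^sup>2 * (2 / (\<delta> / 2)\<^sup>2 * exp (\<delta> * \<bar>s\<bar>)) * exp (\<theta> \<bullet> T x)"
        by (rule mult_right_mono) simp
      moreover have "exp ((\<theta> + t *\<^sub>R u) \<bullet> T x) - exp (\<theta> \<bullet> T x) - t * (s * exp (\<theta> \<bullet> T x)) = (exp (t * s) - 1 - t * s) * exp (\<theta> \<bullet> T x)"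
        by (simp add: s_def inner_add_left exp_add algebra_simps)
      ultimately show "\<bar>exp ((\<theta> + t *\<^sub>R u) \<bullet> T x) - exp (\<theta> \<bullet> T x) - t * ((u \<bullet> T x) * exp (\<theta> \<bullet> T x))\<bar>
          \<le> t\<^sup>2 * (2 / (\<delta> / 2)\<^sup>2 * (exp (\<delta> * \<bar>u \<bullet> T x\<bar>) * exp (\<theta> \<bullet> T x)))"
        by (simp add: abs_mult mult.assoc s_def)
    qed
    also have "\<dots> = t\<^sup>2 * K" by (simp add: K_def)
    finally show ?thesis .
  qed
  have "((\<lambda>t. (Z (\<theta> + t *\<^sub>R u) - Z \<theta>) / t) \<longlongrightarrow> m) (at 0)"
  proof (rule Lim_transform2[of "\<lambda>_. m"])
    show "((\<lambda>t. m - (Z (\<theta> + t *\<^sub>R u) - Z \<theta>) / t) \<longlongrightarrow> 0) (at 0)"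
    proof (rule Lim_null_comparison[where g = "\<lambda>t. \<bar>t\<bar> * K"])
      have "\<forall>\<^sub>F t in at 0. \<bar>t\<bar> < \<delta> / 2 \<and> t \<noteq> 0"
        using \<delta> by (auto simp: eventually_at dist_real_def intro!: exI[of _ "\<delta> / 2"])
      then show "\<forall>\<^sub>F t in at 0. norm (m - (Z (\<theta> + t *\<^sub>R u) - Z \<theta>) / t) \<le> \<bar>t\<bar> * K"
      proof eventually_elim
        case (elim t)
        have "\<bar>m - (Z (\<theta> + t *\<^sub>R u) - Z \<theta>) / t\<bar> = \<bar>Z (\<theta> + t *\<^sub>R u) - Z \<theta> - t * m\<bar> / \<bar>t\<bar>"
        proof -
          have "m - (Z (\<theta> + t *\<^sub>R u) - Z \<theta>) / t = - ((Z (\<theta> + t *\<^sub>R u) - Z \<theta> - t * m) / t)"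
            using elim by (simp add: field_simps)
          then show ?thesis by (simp only: abs_minus_cancel abs_divide)
        qed
        also have "\<dots> \<le> t\<^sup>2 * K / \<bar>t\<bar>"
          using elim bound[of t] by (intro divide_right_mono) auto
        also have "\<dots> = \<bar>t\<bar> * K"
          using elim by (cases "t > 0") (auto simp: power2_eq_square)
        finally show ?case by simp
      qed
      show "((\<lambda>t. \<bar>t\<bar> * K) \<longlongrightarrow> 0) (at 0)"
        by (intro tendsto_mult_left_zero tendsto_rabs_zero tendsto_ident_at)
    qed
  qed simp
  then show ?thesis
    unfolding m_def[symmetric] has_field_derivative_iff by simp
qed

lemma ef_density_measurable [measurable]: "ef_density \<mu> T \<theta> \<in> borel_measurable D"
  unfolding ef_density_def[abs_def] by measurable

lemma ef_density_nonneg: "ef_density \<mu> T \<theta> x \<ge> 0"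
  by (simp add: ef_density_def partition_fun_def)

lemma sets_P [simp, measurable_cong]: "sets (P \<theta>) = sets D"
  by (simp add: ef_measure_def)

lemma integrable_P_iff:
  fixes f :: "_ \<Rightarrow> real"
  assumes "\<theta> \<in> \<Theta>" "f \<in> borel_measurable D"
  shows "integrable (P \<theta>) f \<longleftrightarrow> integrable D (\<lambda>x. f x * exp (\<theta> \<bullet> T x))"
    and "(\<integral>x. f x \<partial>P \<theta>) = (\<integral>x. f x * exp (\<theta> \<bullet> T x) \<partial>D) / Z \<theta>"
proof -
  have eq: "ef_density \<mu> T \<theta> x *\<^sub>R f x = (1 / Z \<theta>) * (f x * exp (\<theta> \<bullet> T x))" for x
    by (simp add: ef_density_def)
  have iff: "integrable D (\<lambda>x. (1 / Z \<theta>) * (f x * exp (\<theta> \<bullet> T x))) \<longleftrightarrow> integrable D (\<lambda>x. f x * exp (\<theta> \<bullet> T x))"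
    using Z_pos[OF assms(1)] by (subst integrable_mult_left_iff) simp
  show "integrable (P \<theta>) f \<longleftrightarrow> integrable D (\<lambda>x. f x * exp (\<theta> \<bullet> T x))"
    unfolding ef_measure_def
    by (subst integrable_density) (simp_all only: eq iff assms ef_density_measurable ef_density_nonneg, simp)
  show "(\<integral>x. f x \<partial>P \<theta>) = (\<integral>x. f x * exp (\<theta> \<bullet> T x) \<partial>D) / Z \<theta>"
    unfolding ef_measure_def
    by (subst integral_density) (simp_all only: eq assms ef_density_measurable ef_density_nonneg
        integral_mult_right_zero, auto)
qed

lemma prob_space_P:
  assumes "\<theta> \<in> \<Theta>"
  shows "prob_space (P \<theta>)"
proof
  have "emeasure (P \<theta>) (space (P \<theta>)) = (\<integral>\<^sup>+x. ennreal (exp (\<theta> \<bullet> T x) / Z \<theta>) \<partial>D)"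
    by (simp add: ef_measure_def emeasure_density ef_density_def)
  also have "\<dots> = ennreal (\<integral>x. exp (\<theta> \<bullet> T x) / Z \<theta> \<partial>D)"
    using assms Z_pos by (intro nn_integral_eq_integral) (auto intro!: integrable_divide integrable_exp less_imp_le)
  also have "\<dots> = 1"
    using Z_pos[OF assms] by (simp add: partition_fun_def)
  finally show "emeasure (P \<theta>) (space (P \<theta>)) = 1" .
qed

definition mean :: "real^'d \<Rightarrow> real^'d" where
  "mean \<theta> = (\<chi> i. \<integral>x. T x $ i \<partial>P \<theta>)"

text \<open>Directional derivative of the log-density: the gradient of ln \<open>Z\<close> is
  \<open>mean\<close>.\<close>

definition score :: "real^'d \<Rightarrow> real^'d \<Rightarrow> real^'m \<Rightarrow> real" where
  "score \<theta> a x = a \<bullet> (T x - mean \<theta>)"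

text \<open>The Fisher metric in parameter coordinates, as \<open>fisher_metric_ef\<close>
  confirms.\<close>

definition covariance :: "real^'d \<Rightarrow> real^'d \<Rightarrow> real^'d \<Rightarrow> real" where
  "covariance \<theta> a b = (\<integral>x. score \<theta> a x * score \<theta> b x \<partial>P \<theta>)"

lemma integrable_P_T:
  assumes "\<theta> \<in> \<Theta>"
  shows "integrable (P \<theta>) (\<lambda>x. u \<bullet> T x)"
    and "integrable (P \<theta>) (\<lambda>x. (u \<bullet> T x) * (v \<bullet> T x))"
proof -
  have "(\<lambda>x. u \<bullet> T x) \<in> borel_measurable D" "(\<lambda>x. (u \<bullet> T x) * (v \<bullet> T x)) \<in> borel_measurable D"
    by measurable
  then show "integrable (P \<theta>) (\<lambda>x. u \<bullet> T x)" "integrable (P \<theta>) (\<lambda>x. (u \<bullet> T x) * (v \<bullet> T x))"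
    using integrable_P_iff(1)[OF assms] integrable_linear_exp[OF assms] integrable_mult_exp[OF assms]
    by blast+
qed

lemma integral_P_T:
  assumes "\<theta> \<in> \<Theta>"
  shows "(\<integral>x. u \<bullet> T x \<partial>P \<theta>) = u \<bullet> mean \<theta>"
proof -
  have int: "integrable (P \<theta>) (\<lambda>x. T x $ i)" for i
    using integrable_P_T(1)[OF assms, of "axis i 1"] by (simp add: inner_axis')
  have "(\<integral>x. u \<bullet> T x \<partial>P \<theta>) = (\<integral>x. (\<Sum>i\<in>UNIV. u $ i * T x $ i) \<partial>P \<theta>)"
    by (simp add: inner_vec_def)
  also have "\<dots> = u \<bullet> mean \<theta>"
    by (subst Bochner_Integration.integral_sum) (auto simp: int inner_vec_def mean_def)
  finally show ?thesis .
qed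

text \<open>One computation covers the three models: (s, k) is (T x, 1) for the family, (the sum of
  the T (x j), n) for its IID extension and (n y, n) for the natural family. The exponential form is
  required on \<Theta> only, because the first two densities take it where \<open>Z\<close> is
  positive.\<close>

lemma partial_derivative_exponential:
  assumes \<theta>: "\<theta> \<in> \<Theta>" and F: "\<And>\<eta>. \<eta> \<in> \<Theta> \<Longrightarrow> F \<eta> = exp (\<eta> \<bullet> s - k * ln (Z \<eta>))"
  shows "(\<Sum>i\<in>UNIV. a $ i * partial_derivative i F \<theta>) = (a \<bullet> (s - k *\<^sub>R mean \<theta>)) * F \<theta>"
proof -
  have "partial_derivative i F \<theta> = (s $ i - k * mean \<theta> $ i) * F \<theta>" for i
  proof -
    let ?u = "axis i 1 :: real^'d"
    have Z': "((\<lambda>t. Z (\<theta> + t *\<^sub>R ?u)) has_real_derivative Z \<theta> * mean \<theta> $ i) (at 0)"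
      using partition_fun_has_derivative[OF \<theta>, of ?u] Z_pos[OF \<theta>]
        integrable_P_iff(2)[OF \<theta>, of "\<lambda>x. T x $ i"] borel_measurable_inner[OF borel_measurable_const T_measurable, of ?u]
      by (simp add: inner_axis' mean_def)
    have "((\<lambda>t. exp ((\<theta> + t *\<^sub>R ?u) \<bullet> s - k * ln (Z (\<theta> + t *\<^sub>R ?u)))) has_real_derivative (s $ i - k * mean \<theta> $ i) * F \<theta>) (at 0)"
    proof -
      have "((\<lambda>t. \<theta> \<bullet> s + t * s $ i - k * ln (Z (\<theta> + t *\<^sub>R ?u))) has_real_derivative s $ i - k * mean \<theta> $ i) (at 0)"
        using Z_pos[OF \<theta>] by (auto intro!: derivative_eq_intros Z')
      from DERIV_fun_exp[OF this] show ?thesis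
        by (simp add: F[OF \<theta>] inner_axis' inner_add_left mult.commute)
    qed
    \<comment> \<open>\<Theta> is open, so the formula holds on a whole neighbourhood of t = 0,
      which is all that the derivative sees.\<close>
    moreover have "\<forall>\<^sub>F t in nhds 0. F (\<theta> + t *\<^sub>R ?u) = exp ((\<theta> + t *\<^sub>R ?u) \<bullet> s - k * ln (Z (\<theta> + t *\<^sub>R ?u)))"
    proof -
      have "open ((\<lambda>t. \<theta> + t *\<^sub>R ?u) -` \<Theta>)"
        by (intro open_vimage param_space_open continuous_intros)
      then have "\<forall>\<^sub>F t in nhds 0. t \<in> (\<lambda>t. \<theta> + t *\<^sub>R ?u) -` \<Theta>"
        using \<theta> by (intro eventually_nhds_in_open) auto
      then show ?thesis by eventually_elim (simp add: F)
    qed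
    ultimately have "((\<lambda>t. F (\<theta> + t *\<^sub>R ?u)) has_real_derivative (s $ i - k * mean \<theta> $ i) * F \<theta>) (at 0)"
      by (subst DERIV_cong_ev[OF refl _ refl])
    then show ?thesis
      unfolding partial_derivative_def by (rule DERIV_imp_deriv)
  qed
  then show ?thesis
    by (simp add: inner_vec_def sum_distrib_right mult.assoc)
qed

end

section \<open>Tangent vectors and the Fisher metric\<close>

text \<open>A tangent space collects all vectors over one measure, whatever parameter they come
  from. Injectivity of the base-point map forces a common parameter, where \<open>eq\<close>
  applies.\<close>

lemma equals_multiple_of_fisherI:
  assumes inj: "inj_on B \<Theta>"
    and \<tau>: "\<And>\<theta> a. \<theta> \<in> \<Theta> \<Longrightarrow> fst (\<tau> \<theta> a) = B \<theta>"
    and eq: "\<And>\<theta> a b. \<theta> \<in> \<Theta> \<Longrightarrow> g (\<tau> \<theta> a) (\<tau> \<theta> b) = c * fisher_metric (\<tau> \<theta> a) (\<tau> \<theta> b)"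
  shows "equals_multiple_of_fisher \<Theta> \<tau> g c"
  unfolding equals_multiple_of_fisher_def
proof (intro allI ballI)
  fix P v w
  assume "v \<in> tangent_space \<Theta> \<tau> P" "w \<in> tangent_space \<Theta> \<tau> P"
  then obtain \<theta> a \<theta>' b where *: "\<theta> \<in> \<Theta>" "\<theta>' \<in> \<Theta>" "v = \<tau> \<theta> a" "w = \<tau> \<theta>' b" "fst v = P" "fst w = P"
    by (auto simp: tangent_space_def tangent_bundle_def)
  then have "\<theta>' = \<theta>" using inj \<tau> by (metis inj_onD)
  then show "g v w = c * fisher_metric v w" using * eq by simp
qed

context regular_exponential_family
begin

lemma score_comb: "score \<theta> (s *\<^sub>R a + t *\<^sub>R b) x = s * score \<theta> a x + t * score \<theta> b x"
  by (simp add: score_def inner_add_left)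

lemma score_measurable [measurable]: "score \<theta> a \<in> borel_measurable D"
  unfolding score_def[abs_def] by measurable

lemma integrable_score:
  assumes "\<theta> \<in> \<Theta>"
  shows "integrable (P \<theta>) (score \<theta> a)"
    and "integrable (P \<theta>) (\<lambda>x. score \<theta> a x * score \<theta> b x)"
proof -
  interpret prob_space "P \<theta>" by (rule prob_space_P[OF assms])
  have s: "score \<theta> a x = a \<bullet> T x - a \<bullet> mean \<theta>" for a x
    by (simp add: score_def inner_diff_right)
  show "integrable (P \<theta>) (score \<theta> a)"
    unfolding s[abs_def] by (intro Bochner_Integration.integrable_diff integrable_P_T assms integrable_const)
  have "score \<theta> a x * score \<theta> b x = (a \<bullet> T x) * (b \<bullet> T x) - (a \<bullet> mean \<theta>) * (b \<bullet> T x)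
      - (b \<bullet> mean \<theta>) * (a \<bullet> T x) + (a \<bullet> mean \<theta>) * (b \<bullet> mean \<theta>)" for x
    unfolding s by (simp add: algebra_simps)
  then show "integrable (P \<theta>) (\<lambda>x. score \<theta> a x * score \<theta> b x)"
    by (simp only:) (intro Bochner_Integration.integrable_diff Bochner_Integration.integrable_add
        integrable_P_T assms integrable_const integrable_mult_right)
qed

lemma integral_score:
  assumes "\<theta> \<in> \<Theta>"
  shows "(\<integral>x. score \<theta> a x \<partial>P \<theta>) = 0"
proof -
  interpret prob_space "P \<theta>" by (rule prob_space_P[OF assms])
  have "(\<integral>x. score \<theta> a x \<partial>P \<theta>) = (\<integral>x. a \<bullet> T x - a \<bullet> mean \<theta> \<partial>P \<theta>)"
    by (simp add: score_def inner_diff_right)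
  also have "\<dots> = (\<integral>x. a \<bullet> T x \<partial>P \<theta>) - (\<integral>x. a \<bullet> mean \<theta> \<partial>P \<theta>)"
    by (intro Bochner_Integration.integral_diff integrable_P_T assms integrable_const)
  also have "(\<integral>x. a \<bullet> mean \<theta> \<partial>P \<theta>) = a \<bullet> mean \<theta>"
    by (simp add: prob_space[simplified])
  finally show ?thesis
    by (simp add: integral_P_T assms)
qed

lemma covariance_sym: "covariance \<theta> a b = covariance \<theta> b a"
  unfolding covariance_def by (simp add: mult.commute)

lemma covariance_comb_left:
  assumes "\<theta> \<in> \<Theta>"
  shows "covariance \<theta> (s *\<^sub>R a + t *\<^sub>R b) c = s * covariance \<theta> a c + t * covariance \<theta> b c"
proof -
  have "covariance \<theta> (s *\<^sub>R a + t *\<^sub>R b) c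
      = (\<integral>x. s * (score \<theta> a x * score \<theta> c x) + t * (score \<theta> b x * score \<theta> c x) \<partial>P \<theta>)"
    by (simp add: covariance_def score_comb ring_distribs mult.assoc)
  also have "\<dots> = s * covariance \<theta> a c + t * covariance \<theta> b c"
    unfolding covariance_def
    by (subst Bochner_Integration.integral_add) (auto intro!: integrable_mult_right integrable_score assms)
  finally show ?thesis .
qed

lemma covariance_linear: "\<theta> \<in> \<Theta> \<Longrightarrow> linear (\<lambda>a. covariance \<theta> a c)"
  using covariance_comb_left[of \<theta> 1 _ 1] covariance_comb_left[of \<theta> _ _ 0]
  by (intro linearI) auto

lemma ef_density_exp: "\<eta> \<in> \<Theta> \<Longrightarrow> ef_density \<mu> T \<eta> x = exp (\<eta> \<bullet> T x - ln (Z \<eta>))"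
  using Z_pos[of \<eta>] by (simp add: ef_density_def exp_diff)

lemma ef_tangent_eq:
  assumes "\<theta> \<in> \<Theta>"
  shows "ef_tangent \<mu> T \<theta> a = (P \<theta>, signed_density (P \<theta>) (score \<theta> a))"
proof -
  have "(\<Sum>i\<in>UNIV. a $ i * partial_derivative i (\<lambda>\<eta>. ef_density \<mu> T \<eta> x) \<theta>)
      = score \<theta> a x * ef_density \<mu> T \<theta> x" for x
    using partial_derivative_exponential[OF assms, of "\<lambda>\<eta>. ef_density \<mu> T \<eta> x" "T x" 1 a]
    by (simp add: ef_density_exp score_def)
  then show ?thesis
    unfolding ef_tangent_def ef_measure_def
    by (simp add: signed_density_density ef_density_nonneg)
qed

text \<open>Zero variance would make the score vanish almost everywhere, and with it the tangent
  vector, against \<open>immersion\<close>.\<close>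

lemma covariance_pos:
  assumes "\<theta> \<in> \<Theta>" "a \<noteq> 0"
  shows "covariance \<theta> a a > 0"
proof -
  have "covariance \<theta> a a \<noteq> 0"
  proof
    assume "covariance \<theta> a a = 0"
    then have "AE x in P \<theta>. score \<theta> a x * score \<theta> a x = 0"
      unfolding covariance_def
      by (subst (asm) integral_nonneg_eq_0_iff_AE) (auto simp: integrable_score assms)
    then have "AE x in P \<theta>. score \<theta> a x = 0" by auto
    then have "snd (ef_tangent \<mu> T \<theta> a) = (\<lambda>_. 0)"
      by (simp add: ef_tangent_eq[OF assms(1)] signed_density_AE_zero)
    with immersion assms show False by blast
  qed
  moreover have "covariance \<theta> a a \<ge> 0"
    unfolding covariance_def by simp
  ultimately show ?thesis by simp
qed

text \<open>The density p of \<open>P \<theta>\<close> is everywhere positive, so \<open>D\<close>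
  is conversely \<open>P \<theta>\<close> reweighted by the finite density 1 / p. Fubini on products
  of \<open>D\<close> depends on this.\<close>

lemma sigma_finite_D: "sigma_finite_measure D"
proof -
  obtain \<theta> where \<theta>: "\<theta> \<in> \<Theta>" using param_space_nonempty by blast
  interpret prob_space "P \<theta>" by (rule prob_space_P[OF \<theta>])
  have pos: "ef_density \<mu> T \<theta> x > 0" for x
    using Z_pos[OF \<theta>] by (simp add: ef_density_def)
  have "density (P \<theta>) (\<lambda>x. ennreal (1 / ef_density \<mu> T \<theta> x))
      = density D (\<lambda>x. ennreal (ef_density \<mu> T \<theta> x) * ennreal (1 / ef_density \<mu> T \<theta> x))"
    unfolding ef_measure_def by (subst density_density_eq) auto
  also have "\<dots> = density D (\<lambda>_. 1)"
    using pos by (intro density_cong) (auto simp: ennreal_mult'[symmetric] less_imp_le less_imp_neq[THEN not_sym])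
  also have "\<dots> = D" by (rule density_1)
  finally have "D = density (P \<theta>) (\<lambda>x. ennreal (1 / ef_density \<mu> T \<theta> x))" ..
  moreover have "sigma_finite_measure (density (P \<theta>) (\<lambda>x. ennreal (1 / ef_density \<mu> T \<theta> x)))"
    by (subst sigma_finite_iff_density_finite) auto
  ultimately show ?thesis by simp
qed

lemma iid_density_exp:
  assumes "\<eta> \<in> \<Theta>"
  shows "iid_density \<mu> T n \<eta> x = exp (\<eta> \<bullet> (\<Sum>j<n. T (x j)) - real n * ln (Z \<eta>))"
proof -
  have "iid_density \<mu> T n \<eta> x = exp (\<Sum>j<n. \<eta> \<bullet> T (x j) - ln (Z \<eta>))"
    by (simp add: iid_density_def ef_density_exp[OF assms] exp_sum)
  then show ?thesis by (simp add: sum_subtractf inner_sum_right)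
qed

lemma iid_density_nonneg: "iid_density \<mu> T n \<eta> x \<ge> 0"
  by (auto simp: iid_density_def intro!: prod_nonneg ef_density_nonneg)

lemma iid_density_measurable [measurable]: "iid_density \<mu> T n \<theta> \<in> borel_measurable (iid_power n D)"
  unfolding iid_density_def[abs_def] by (intro borel_measurable_prod measurable_iid_component) auto

lemma sets_iid_power_P [simp, measurable_cong]: "sets (iid_power n (P \<theta>)) = sets (iid_power n D)"
  unfolding iid_power_def by (intro sets_PiM_cong) auto

text \<open>Base-points are defined as product measures, tangent components as densities over the
  product of \<open>D\<close>; this links the two. Both sides agree on boxes, where density and
  indicator factor over the coordinates.\<close>

lemma iid_power_P:
  assumes "\<theta> \<in> \<Theta>"
  shows "iid_power n (P \<theta>) = density (iid_power n D) (\<lambda>x. ennreal (iid_density \<mu> T n \<theta> x))"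
proof -
  interpret prob_space "P \<theta>" by (rule prob_space_P[OF assms])
  interpret PP: product_sigma_finite "\<lambda>_::nat. P \<theta>" ..
  interpret sigma_finite_measure D by (rule sigma_finite_D)
  interpret DD: product_sigma_finite "\<lambda>_::nat. D" ..
  have "density (iid_power n D) (\<lambda>x. ennreal (iid_density \<mu> T n \<theta> x)) = Pi\<^sub>M {..<n} (\<lambda>_. P \<theta>)"
  proof (rule PP.PiM_eqI)
    show "sets (density (iid_power n D) (\<lambda>x. ennreal (iid_density \<mu> T n \<theta> x))) = sets (Pi\<^sub>M {..<n} (\<lambda>_. P \<theta>))"
      using sets_iid_power_P[of n \<theta>] by (simp add: iid_power_def)
    fix A assume "\<And>i. i \<in> {..<n} \<Longrightarrow> A i \<in> sets (P \<theta>)"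
    then have A: "\<And>i. i < n \<Longrightarrow> A i \<in> sets D" by simp
    have "emeasure (density (iid_power n D) (\<lambda>x. ennreal (iid_density \<mu> T n \<theta> x))) (Pi\<^sub>E {..<n} A)
        = (\<integral>\<^sup>+x. ennreal (iid_density \<mu> T n \<theta> x) * indicator (Pi\<^sub>E {..<n} A) x \<partial>iid_power n D)"
      using A sets_PiM_I_finite[of "{..<n}" A "\<lambda>_. D"]
      by (intro emeasure_density) (measurable, auto simp: iid_power_def)
    also have "\<dots> = (\<integral>\<^sup>+x. (\<Prod>j<n. ennreal (ef_density \<mu> T \<theta> (x j)) * indicator (A j) (x j)) \<partial>iid_power n D)"
    proof (rule nn_integral_cong)
      fix x assume x: "x \<in> space (iid_power n D)"
      then have "indicator (Pi\<^sub>E {..<n} A) x = (\<Prod>j<n. indicator (A j) (x j) :: ennreal)"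
        by (auto simp: iid_power_def space_PiM indicator_def PiE_iff prod_zero_iff)
      then show "ennreal (iid_density \<mu> T n \<theta> x) * indicator (Pi\<^sub>E {..<n} A) x
          = (\<Prod>j<n. ennreal (ef_density \<mu> T \<theta> (x j)) * indicator (A j) (x j))"
        by (simp add: iid_density_def prod_ennreal ef_density_nonneg prod.distrib)
    qed
    also have "\<dots> = (\<Prod>j<n. \<integral>\<^sup>+x. ennreal (ef_density \<mu> T \<theta> x) * indicator (A j) x \<partial>D)"
      unfolding iid_power_def using A by (intro DD.product_nn_integral_prod) auto
    also have "\<dots> = (\<Prod>i<n. emeasure (P \<theta>) (A i))"
      using A by (intro prod.cong) (auto simp: ef_measure_def emeasure_density)
    finally show "emeasure (density (iid_power n D) (\<lambda>x. ennreal (iid_density \<mu> T n \<theta> x))) (Pi\<^sub>E {..<n} A)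
        = (\<Prod>i\<in>{..<n}. emeasure (P \<theta>) (A i))" .
  qed simp
  then show ?thesis by (simp add: iid_power_def)
qed

section \<open>Scores of the IID extensions and of the natural families\<close>

definition iid_score :: "nat \<Rightarrow> real^'d \<Rightarrow> real^'d \<Rightarrow> (nat \<Rightarrow> real^'m) \<Rightarrow> real" where
  "iid_score n \<theta> a x = (\<Sum>j<n. score \<theta> a (x j))"

lemma iid_score_measurable [measurable]: "iid_score n \<theta> a \<in> borel_measurable (iid_power n D)"
  unfolding iid_score_def[abs_def] by (rule measurable_iid_sum) measurable

lemma iid_score_eq: "iid_score n \<theta> a x = a \<bullet> ((\<Sum>j<n. T (x j)) - real n *\<^sub>R mean \<theta>)"
  by (simp add: iid_score_def score_def inner_diff_right sum_subtractf inner_sum_right)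

lemma iid_tangent_eq:
  assumes "\<theta> \<in> \<Theta>"
  shows "iid_tangent \<mu> T n \<theta> a
    = (iid_power n (P \<theta>), signed_density (iid_power n (P \<theta>)) (iid_score n \<theta> a))"
proof -
  have "(\<Sum>i\<in>UNIV. a $ i * partial_derivative i (\<lambda>\<eta>. iid_density \<mu> T n \<eta> x) \<theta>)
      = iid_score n \<theta> a x * iid_density \<mu> T n \<theta> x" for x
    using partial_derivative_exponential[OF assms, of "\<lambda>\<eta>. iid_density \<mu> T n \<eta> x" "\<Sum>j<n. T (x j)" "real n" a]
    by (simp add: iid_density_exp iid_score_eq)
  then show ?thesis
    unfolding iid_tangent_def
    by (simp add: iid_power_P[OF assms] signed_density_density iid_density_nonneg)
qed

definition nat_measure :: "nat \<Rightarrow> real^'d \<Rightarrow> (real^'d) measure" where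
  "nat_measure n \<theta> = distr (iid_power n (P \<theta>)) borel (mean_statistic T n)"

definition nat_score :: "nat \<Rightarrow> real^'d \<Rightarrow> real^'d \<Rightarrow> real^'d \<Rightarrow> real" where
  "nat_score n \<theta> a y = real n * (a \<bullet> (y - mean \<theta>))"

lemma nat_score_measurable [measurable]: "nat_score n \<theta> a \<in> borel_measurable borel"
  unfolding nat_score_def[abs_def] by measurable

lemma mean_statistic_measurable [measurable]: "mean_statistic T n \<in> borel_measurable (iid_power n D)"
proof -
  have [measurable]: "(\<lambda>x. \<Sum>j<n. T (x j)) \<in> borel_measurable (iid_power n D)"
    by (rule measurable_iid_sum) measurable
  show ?thesis unfolding mean_statistic_def[abs_def] by measurable
qed

lemma mean_statistic_measurable_P [measurable]: "mean_statistic T n \<in> borel_measurable (iid_power n (P \<theta>))"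
  using mean_statistic_measurable by (simp add: measurable_cong_sets[OF sets_iid_power_P refl])

lemma sets_nat_measure [simp, measurable_cong]: "sets (nat_measure n \<theta>) = sets borel"
  by (simp add: nat_measure_def)

text \<open>The IID score depends on the sample only through \<open>mean_statistic\<close>, an
  instance of sufficiency; hence the Fisher metrics of the IID extension and of the natural family
  coincide.\<close>

lemma nat_score_mean_statistic: "n \<ge> 1 \<Longrightarrow> nat_score n \<theta> a (mean_statistic T n x) = iid_score n \<theta> a x"
  unfolding nat_score_def mean_statistic_def iid_score_eq
  by (simp add: inner_diff_right right_diff_distrib)

lemma nat_tangent_eq:
  assumes "\<theta> \<in> \<Theta>" "n \<ge> 1"
  shows "nat_tangent \<mu> T n \<theta> a = (nat_measure n \<theta>, signed_density (nat_measure n \<theta>) (nat_score n \<theta> a))"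
proof -
  have [measurable]: "nat_density \<mu> T n \<theta> \<in> borel_measurable borel"
    unfolding nat_density_def[abs_def] by measurable
  have "(\<Sum>i\<in>UNIV. a $ i * partial_derivative i (\<lambda>\<eta>. nat_density \<mu> T n \<eta> y) \<theta>)
      = nat_score n \<theta> a y * nat_density \<mu> T n \<theta> y" for y
    using partial_derivative_exponential[OF assms(1), of "\<lambda>\<eta>. nat_density \<mu> T n \<eta> y" "real n *\<^sub>R y" "real n" a]
    by (simp add: nat_density_def nat_score_def inner_diff_right right_diff_distrib)
  \<comment> \<open>The base-point is defined as a push-forward; since \<open>iid_density\<close>
    factors through \<open>mean_statistic\<close>, that push-forward has \<open>nat_density\<close>
    as its density.\<close>
  moreover have "nat_measure n \<theta> = density (nat_dominating \<mu> T n) (\<lambda>y. ennreal (nat_density \<mu> T n \<theta> y))"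
  proof -
    have "nat_density \<mu> T n \<theta> (mean_statistic T n x) = iid_density \<mu> T n \<theta> x" for x
      using assms by (simp add: nat_density_def iid_density_exp mean_statistic_def)
    then show ?thesis
      unfolding nat_dominating_def nat_measure_def iid_power_P[OF assms(1)]
      by (subst density_distr) auto
  qed
  moreover have "nat_density \<mu> T n \<theta> y \<ge> 0" for y
    by (simp add: nat_density_def)
  moreover have "signed_density (density (nat_dominating \<mu> T n) (\<lambda>y. ennreal (nat_density \<mu> T n \<theta> y))) (nat_score n \<theta> a)
      = signed_density (nat_dominating \<mu> T n) (\<lambda>y. nat_score n \<theta> a y * nat_density \<mu> T n \<theta> y)"
    by (rule signed_density_density) (auto simp: nat_dominating_def nat_density_def)
  ultimately show ?thesis
    unfolding nat_tangent_def by (simp add: nat_measure_def)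
qed

lemma integrable_iid_score:
  assumes "\<theta> \<in> \<Theta>"
  shows "integrable (iid_power n (P \<theta>)) (iid_score n \<theta> a)"
  unfolding iid_score_def[abs_def]
  using integral_iid_component(2)[OF prob_space_P[OF assms], of _ n "score \<theta> a"] integrable_score(1)[OF assms]
  by (intro Bochner_Integration.integrable_sum) auto

lemma integral_iid_score_mult:
  assumes "\<theta> \<in> \<Theta>"
  shows "(\<integral>x. iid_score n \<theta> a x * iid_score n \<theta> b x \<partial>iid_power n (P \<theta>)) = real n * covariance \<theta> a b"
  unfolding iid_score_def covariance_def
  by (intro integral_iid_sum_mult_sum prob_space_P integrable_score integral_score assms)

lemma fisher_metric_ef:
  assumes "\<theta> \<in> \<Theta>"
  shows "fisher_metric (ef_tangent \<mu> T \<theta> a) (ef_tangent \<mu> T \<theta> b) = covariance \<theta> a b"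
  by (simp add: ef_tangent_eq assms fisher_metric_signed_density integrable_score covariance_def)

lemma fisher_metric_iid:
  assumes "\<theta> \<in> \<Theta>"
  shows "fisher_metric (iid_tangent \<mu> T n \<theta> a) (iid_tangent \<mu> T n \<theta> b) = real n * covariance \<theta> a b"
  by (simp add: iid_tangent_eq assms fisher_metric_signed_density integrable_iid_score integral_iid_score_mult)

lemma integrable_nat_score:
  assumes "\<theta> \<in> \<Theta>" "n \<ge> 1"
  shows "integrable (nat_measure n \<theta>) (nat_score n \<theta> a)"
  unfolding nat_measure_def
  by (subst integrable_distr_eq) (use assms in \<open>auto simp: nat_score_mean_statistic integrable_iid_score\<close>)

lemma fisher_metric_nat:
  assumes "\<theta> \<in> \<Theta>" "n \<ge> 1"
  shows "fisher_metric (nat_tangent \<mu> T n \<theta> a) (nat_tangent \<mu> T n \<theta> b) = real n * covariance \<theta> a b"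
proof -
  have "(\<integral>y. nat_score n \<theta> a y * nat_score n \<theta> b y \<partial>nat_measure n \<theta>) = real n * covariance \<theta> a b"
    unfolding nat_measure_def
    by (subst integral_distr) (use assms in \<open>auto simp: nat_score_mean_statistic integral_iid_score_mult\<close>)
  then show ?thesis
    using assms by (simp add: nat_tangent_eq fisher_metric_signed_density integrable_nat_score)
qed

text \<open>If the means agree then the symmetrised Kullback-Leibler divergence of \<open>P \<theta>\<close> and \<open>P \<theta>'\<close>,
  which is \<open>(\<theta> - \<theta>') \<bullet> (mean \<theta> - mean \<theta>')\<close>, vanishes.\<close>

lemma mean_inj: "inj_on mean \<Theta>"
proof
  fix \<theta> \<theta>' assume \<theta>: "\<theta> \<in> \<Theta>" "\<theta>' \<in> \<Theta>" and eq: "mean \<theta> = mean \<theta>'"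
  define h where "h x = (\<theta> - \<theta>') \<bullet> T x - (ln (Z \<theta>) - ln (Z \<theta>'))" for x
  let ?p = "ef_density \<mu> T \<theta>" and ?p' = "ef_density \<mu> T \<theta>'"
  have [measurable]: "h \<in> borel_measurable D" unfolding h_def by measurable
  have pos: "?p x > 0" "?p' x > 0" for x using \<theta> Z_pos by (auto simp: ef_density_def)
  have h: "h x = ln (?p x) - ln (?p' x)" for x
    by (simp add: ef_density_exp \<theta> h_def inner_diff_left)
  have H: "integrable D (\<lambda>x. ef_density \<mu> T \<eta> x * h x)"
    "(\<integral>x. ef_density \<mu> T \<eta> x * h x \<partial>D) = (\<theta> - \<theta>') \<bullet> mean \<eta> - (ln (Z \<theta>) - ln (Z \<theta>'))" if "\<eta> \<in> \<Theta>" for \<eta>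
  proof -
    interpret prob_space "P \<eta>" by (rule prob_space_P[OF that])
    have "integrable (P \<eta>) h"
      unfolding h_def by (intro Bochner_Integration.integrable_diff integrable_P_T that integrable_const)
    moreover have "(\<integral>x. h x \<partial>P \<eta>) = (\<theta> - \<theta>') \<bullet> mean \<eta> - (ln (Z \<theta>) - ln (Z \<theta>'))"
      unfolding h_def
      by (subst Bochner_Integration.integral_diff)
         (auto intro!: integrable_P_T that simp: integral_P_T[OF that] prob_space[simplified])
    ultimately show "integrable D (\<lambda>x. ef_density \<mu> T \<eta> x * h x)"
      "(\<integral>x. ef_density \<mu> T \<eta> x * h x \<partial>D) = (\<theta> - \<theta>') \<bullet> mean \<eta> - (ln (Z \<theta>) - ln (Z \<theta>'))"
      by (simp_all add: ef_measure_def integrable_density integral_density ef_density_nonneg)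
  qed
  \<comment> \<open>The integrand is (p - p') (ln p - ln p'), non-negative because ln is increasing,
    and zero only where p = p'.\<close>
  have nonneg: "0 \<le> ?p x * h x - ?p' x * h x" for x
  proof -
    have "0 \<le> (?p x - ?p' x) * (ln (?p x) - ln (?p' x))"
      using pos[of x] by (cases "?p x \<le> ?p' x") (auto intro: mult_nonpos_nonpos mult_nonneg_nonneg)
    then show ?thesis by (simp add: h left_diff_distrib)
  qed
  have "(\<integral>x. ?p x * h x - ?p' x * h x \<partial>D) = 0"
    using H \<theta> eq by simp
  then have "AE x in D. ?p x * h x - ?p' x * h x = 0"
    using nonneg H \<theta> by (subst (asm) integral_nonneg_eq_0_iff_AE) auto
  then have "AE x in D. ?p x = ?p' x"
  proof eventually_elim
    case (elim x)
    then have "(?p x - ?p' x) * (ln (?p x) - ln (?p' x)) = 0"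
      by (simp add: h left_diff_distrib)
    then show ?case using pos[of x] by auto
  qed
  then have "P \<theta> = P \<theta>'"
    unfolding ef_measure_def by (intro density_cong) auto
  with inj_param \<theta> show "\<theta> = \<theta>'" by (auto dest: inj_onD)
qed

text \<open>Averaging does not change the mean, so the push-forward still has mean
  \<open>mean \<theta>\<close> and determines the parameter through \<open>mean_inj\<close>.\<close>

lemma nat_measure_inj:
  assumes n: "n \<ge> 1"
  shows "inj_on (nat_measure n) \<Theta>"
proof
  fix \<theta> \<theta>' assume \<theta>: "\<theta> \<in> \<Theta>" "\<theta>' \<in> \<Theta>" and eq: "nat_measure n \<theta> = nat_measure n \<theta>'"
  have m: "(\<integral>y. u \<bullet> y \<partial>nat_measure n \<eta>) = u \<bullet> mean \<eta>" if \<eta>: "\<eta> \<in> \<Theta>" for u \<eta>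
  proof -
    have "(\<integral>y. u \<bullet> y \<partial>nat_measure n \<eta>) = (\<integral>x. (1 / n) * (\<Sum>j<n. u \<bullet> T (x j)) \<partial>iid_power n (P \<eta>))"
      unfolding nat_measure_def
      by (subst integral_distr) (auto simp: mean_statistic_def inner_sum_right)
    also have "\<dots> = (1 / n) * (\<integral>x. (\<Sum>j<n. u \<bullet> T (x j)) \<partial>iid_power n (P \<eta>))"
      by (rule integral_mult_right_zero)
    also have "(\<integral>x. (\<Sum>j<n. u \<bullet> T (x j)) \<partial>iid_power n (P \<eta>)) = (\<Sum>j<n. \<integral>x. u \<bullet> T (x j) \<partial>iid_power n (P \<eta>))"
      using integral_iid_component(2)[OF prob_space_P[OF \<eta>], of _ n "\<lambda>x. u \<bullet> T x"] integrable_P_T(1)[OF \<eta>]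
      by (intro Bochner_Integration.integral_sum) auto
    also have "\<dots> = (\<Sum>j<n. u \<bullet> mean \<eta>)"
      using integral_iid_component(1)[OF prob_space_P[OF \<eta>], of _ n "\<lambda>x. u \<bullet> T x"]
      by (intro sum.cong) (auto simp: integral_P_T[OF \<eta>])
    finally show ?thesis using n by simp
  qed
  have "u \<bullet> (mean \<theta> - mean \<theta>') = 0" for u
    using m[OF \<theta>(1), of u] m[OF \<theta>(2), of u] eq by (simp add: inner_diff_right)
  then have "mean \<theta> = mean \<theta>'" by (metis inner_eq_zero_iff right_minus_eq)
  with mean_inj \<theta> show "\<theta> = \<theta>'" by (auto dest: inj_onD)
qed

lemma iid_power_P_inj:
  assumes "n \<ge> 1"
  shows "inj_on (\<lambda>\<theta>. iid_power n (P \<theta>)) \<Theta>"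
  using nat_measure_inj[OF assms] unfolding inj_on_def nat_measure_def by metis

text \<open>Gram-Schmidt for the covariance form, by induction on the set of indices already filled.
  Keeping \<open>i0\<close> in this set throughout holds the prescribed vector \<open>a\<close> in
  its slot.\<close>

lemma covariance_orthonormal_basis:
  fixes i0 :: 'd
  assumes \<theta>: "\<theta> \<in> \<Theta>" and a: "covariance \<theta> a a = 1"
  obtains w :: "'d \<Rightarrow> real^'d" where "w i0 = a" "\<And>i j. covariance \<theta> (w i) (w j) = (if i = j then 1 else 0)"
proof -
  have "\<exists>w :: 'd \<Rightarrow> real^'d. w i0 = a \<and> (\<forall>i\<in>insert i0 I. \<forall>j\<in>insert i0 I. covariance \<theta> (w i) (w j) = (if i = j then 1 else 0))"
    for I :: "'d set"
    using finite[of I]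
  proof induction
    case empty
    show ?case by (rule exI[of _ "\<lambda>_. a"]) (simp add: a)
  next
    case (insert k F)
    let ?I = "insert i0 F"
    obtain w where w: "w i0 = a"
      "\<And>i j. i \<in> ?I \<Longrightarrow> j \<in> ?I \<Longrightarrow> covariance \<theta> (w i) (w j) = (if i = j then 1 else 0)"
      using insert.IH by blast
    show ?case
    proof (cases "k \<in> ?I")
      case True
      then show ?thesis using w by (intro exI[of _ w]) (auto simp: insert_absorb)
    next
      case False
      \<comment> \<open>With k unfilled, fewer than d vectors have been chosen, so they cannot span;
        this is what makes the remainder v' below non-zero.\<close>
      have "dim (w ` ?I) \<le> card (w ` ?I)" by (rule dim_le_card') simp
      also have "\<dots> \<le> card ?I" by (rule card_image_le) simp
      also have "\<dots> < card (UNIV :: 'd set)"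
        using False by (intro psubset_card_mono) auto
      finally have "span (w ` ?I) \<noteq> UNIV"
        by (metis DIM_cart DIM_real dim_UNIV dim_span less_irrefl mult.right_neutral)
      then obtain v where v: "v \<notin> span (w ` ?I)" by blast
      define v' where "v' = v - (\<Sum>i\<in>?I. covariance \<theta> v (w i) *\<^sub>R w i)"
      have "v' \<noteq> 0"
      proof
        assume "v' = 0"
        then have "v = (\<Sum>i\<in>?I. covariance \<theta> v (w i) *\<^sub>R w i)" by (simp add: v'_def)
        also have "\<dots> \<in> span (w ` ?I)"
          by (intro span_sum span_scale span_base) auto
        finally show False using v by simp
      qed
      then have c: "covariance \<theta> v' v' > 0" by (rule covariance_pos[OF \<theta>])
      have v'w: "covariance \<theta> v' (w j) = 0" if "j \<in> ?I" for j
      proof -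
        interpret linear "\<lambda>b. covariance \<theta> b (w j)" by (rule covariance_linear[OF \<theta>])
        have "covariance \<theta> v' (w j) = covariance \<theta> v (w j) - (\<Sum>i\<in>?I. covariance \<theta> v (w i) * covariance \<theta> (w i) (w j))"
          by (simp add: v'_def diff sum scale)
        also have "(\<Sum>i\<in>?I. covariance \<theta> v (w i) * covariance \<theta> (w i) (w j)) = (\<Sum>i\<in>?I. if i = j then covariance \<theta> v (w j) else 0)"
          using that w(2) by (intro sum.cong) auto
        also have "\<dots> = covariance \<theta> v (w j)"
          using that by (subst sum.delta) auto
        finally show ?thesis by simp
      qed
      define b where "b = (1 / sqrt (covariance \<theta> v' v')) *\<^sub>R v'"
      have b_left: "covariance \<theta> b y = (1 / sqrt (covariance \<theta> v' v')) * covariance \<theta> v' y" for y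
        using covariance_comb_left[OF \<theta>, of "1 / sqrt (covariance \<theta> v' v')" v' 0 0 y] by (simp add: b_def)
      have bw: "covariance \<theta> b (w j) = 0" "covariance \<theta> (w j) b = 0" if "j \<in> ?I" for j
        using b_left[of "w j"] v'w[OF that] covariance_sym[of \<theta> b "w j"] by auto
      have "covariance \<theta> b b = 1"
        using c b_left[of b] b_left[of v'] covariance_sym[of \<theta> v' b]
        by (simp add: field_simps)
      then show ?thesis
        using w bw False by (intro exI[of _ "w(k := b)"]) auto
    qed
  qed
  from this[of UNIV] show ?thesis using that by auto
qed

end

section \<open>Whitening\<close>

context regular_exponential_family
begin

context
  fixes \<theta> :: "real^'d" and w :: "'d \<Rightarrow> real^'d"
  assumes \<theta>: "\<theta> \<in> \<Theta>"
    and w: "\<And>i j. covariance \<theta> (w i) (w j) = (if i = j then 1 else 0)"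
begin

definition whitened :: "real^'m \<Rightarrow> real^'d" where
  "whitened x = (\<chi> i. score \<theta> (w i) x)"

text \<open>The covariance of the mean statistic is 1 / n times that of T, which the factor sqrt n
  in the rows compensates.\<close>

definition whitening_matrix :: "nat \<Rightarrow> real^'d^'d" where
  "whitening_matrix n = (\<chi> i. sqrt n *\<^sub>R w i)"

text \<open>Written literally as M y + b, the shape of the affine maps in (A3)(iv).\<close>

definition whitening_map :: "nat \<Rightarrow> real^'d \<Rightarrow> real^'d" where
  "whitening_map n y = whitening_matrix n *v y + (- (whitening_matrix n *v mean \<theta>))"

text \<open>Every functional of the whitened sample is again a score, so its moments reduce to
  \<open>integral_score\<close> and \<open>covariance\<close>.\<close>

lemma inner_whitened: "u \<bullet> whitened x = score \<theta> (\<Sum>i\<in>UNIV. u $ i *\<^sub>R w i) x"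
  by (simp add: whitened_def inner_vec_def[of u] score_def inner_sum_left)

lemma covariance_sum_left: "covariance \<theta> (\<Sum>i\<in>UNIV. u $ i *\<^sub>R w i) a = (\<Sum>i\<in>UNIV. u $ i * covariance \<theta> (w i) a)"
proof -
  interpret linear "\<lambda>b. covariance \<theta> b a" by (rule covariance_linear[OF \<theta>])
  show ?thesis by (simp add: sum scale)
qed

lemma covariance_sum_basis: "covariance \<theta> (\<Sum>i\<in>UNIV. u $ i *\<^sub>R w i) (w j) = u $ j"
  by (simp add: covariance_sum_left w if_distrib cong: if_cong)

lemma covariance_sum_sum: "covariance \<theta> (\<Sum>i\<in>UNIV. u $ i *\<^sub>R w i) (\<Sum>i\<in>UNIV. v $ i *\<^sub>R w i) = u \<bullet> v"
proof -
  have "covariance \<theta> (w j) (\<Sum>i\<in>UNIV. v $ i *\<^sub>R w i) = v $ j" for j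
    using covariance_sum_basis[of v j] covariance_sym by simp
  then show ?thesis
    by (subst covariance_sum_left) (simp add: inner_vec_def)
qed

lemma standardized_sample_whitened: "standardized_sample (P \<theta>) whitened"
proof (rule standardized_sample.intro)
  show "prob_space (P \<theta>)" by (rule prob_space_P[OF \<theta>])
  have "(\<lambda>x. score \<theta> a x) \<in> borel_measurable (P \<theta>)" for a
    using integrable_score(1)[OF \<theta>, of a] by auto
  then show "whitened \<in> borel_measurable (P \<theta>)"
    by (subst borel_measurable_euclidean_space) (auto simp: Basis_vec_def inner_axis whitened_def)
  show "integrable (P \<theta>) (\<lambda>x. u \<bullet> whitened x)" for u
    unfolding inner_whitened by (rule integrable_score[OF \<theta>])
  show "(\<integral>x. u \<bullet> whitened x \<partial>P \<theta>) = 0" for u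
    unfolding inner_whitened by (rule integral_score[OF \<theta>])
  show "integrable (P \<theta>) (\<lambda>x. (u \<bullet> whitened x) * (v \<bullet> whitened x))" for u v
    unfolding inner_whitened by (rule integrable_score[OF \<theta>])
  show "(\<integral>x. (u \<bullet> whitened x) * (v \<bullet> whitened x) \<partial>P \<theta>) = u \<bullet> v" for u v
    unfolding inner_whitened using covariance_sum_sum[of u v] by (simp add: covariance_def)
qed

interpretation standardized_sample "P \<theta>" whitened
  by (rule standardized_sample_whitened)

text \<open>The transpose maps x to sqrt n times the combination of the \<open>w i\<close> with
  coefficients x. Pairing with \<open>w j\<close> by the covariance returns sqrt n times coordinate
  j of x, so the kernel is trivial.\<close>

lemma invertible_whitening_matrix:
  assumes "n \<ge> 1"
  shows "invertible (whitening_matrix n)"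
proof -
  have "x = 0" if "transpose (whitening_matrix n) *v x = 0" for x
  proof -
    have "transpose (whitening_matrix n) *v x = (\<Sum>i\<in>UNIV. (sqrt n *\<^sub>R x) $ i *\<^sub>R w i)"
      by (simp add: vec_eq_iff matrix_vector_mult_def transpose_def whitening_matrix_def mult_ac)
    then have "(sqrt n *\<^sub>R x) $ j = covariance \<theta> 0 (w j)" for j
      using that covariance_sum_basis[of "sqrt n *\<^sub>R x" j] by simp
    moreover have "covariance \<theta> 0 (w j) = 0" for j
      by (rule linear_0[OF covariance_linear[OF \<theta>]])
    ultimately have "sqrt n * x $ j = 0" for j by simp
    then show "x = 0" using assms by (simp add: vec_eq_iff)
  qed
  then have "invertible (transpose (whitening_matrix n))"
    unfolding invertible_left_inverse matrix_left_invertible_ker by blast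
  then show ?thesis
    using transpose_invertible by fastforce
qed

lemma whitening_map_nth: "whitening_map n y $ i = sqrt n * (w i \<bullet> (y - mean \<theta>))"
  by (simp add: whitening_map_def whitening_matrix_def matrix_vector_mult_def inner_vec_def
      sum_subtractf right_diff_distrib sum_distrib_left mult.assoc)

lemma whitening_map_measurable [measurable]: "whitening_map n \<in> borel_measurable borel"
  unfolding whitening_map_def[abs_def]
  by (intro borel_measurable_continuous_onI continuous_intros matrix_vector_mult_linear_continuous_on)

lemma whitening_map_mean_statistic:
  assumes "n \<ge> 1"
  shows "whitening_map n (mean_statistic T n x) = normed_sum n x"
proof -
  have "whitening_map n (mean_statistic T n x) $ i = normed_sum n x $ i" for i
  proof -
    have "w i \<bullet> (mean_statistic T n x - mean \<theta>) = (1 / n) * iid_score n \<theta> (w i) x"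
      using nat_score_mean_statistic[OF assms, of \<theta> "w i" x] assms by (simp add: nat_score_def field_simps)
    then have "whitening_map n (mean_statistic T n x) $ i = (sqrt n / n) * iid_score n \<theta> (w i) x"
      by (simp add: whitening_map_nth)
    also have "sqrt n / n = 1 / sqrt n"
      using assms by (simp add: field_simps)
    finally show ?thesis
      by (simp add: normed_sum_def whitened_def iid_score_def)
  qed
  then show ?thesis by (simp add: vec_eq_iff)
qed

lemma distr_whitening_map:
  assumes "n \<ge> 1"
  shows "distr (nat_measure n \<theta>) borel (whitening_map n) = law n"
  unfolding nat_measure_def law_def
  by (subst distr_distr) (auto simp: comp_def whitening_map_mean_statistic[OF assms])

text \<open>The natural score carries a factor n, and n / sqrt n = sqrt n is the factor in the
  whitening map. In the direction \<open>w i\<close> / sqrt n the score is therefore exactly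
  coordinate i of the whitened point, a density that no longer involves n.\<close>

lemma signed_distr_whitening_map:
  assumes "n \<ge> 1"
  shows "signed_distr (nat_measure n \<theta>) borel (whitening_map n)
      (signed_density (nat_measure n \<theta>) (nat_score n \<theta> ((1 / sqrt n) *\<^sub>R w i)))
    = signed_density (law n) (\<lambda>y. y $ i)"
proof -
  have "real n * ((1 / sqrt n) * s) = sqrt n * s" for s
    using assms by (simp add: field_simps flip: real_sqrt_mult_self[of "real n"])
  then have "nat_score n \<theta> ((1 / sqrt n) *\<^sub>R w i) = (\<lambda>y. whitening_map n y $ i)"
    by (simp add: fun_eq_iff nat_score_def whitening_map_nth)
  moreover have "whitening_map n \<in> nat_measure n \<theta> \<rightarrow>\<^sub>M borel"
    using whitening_map_measurable by (simp add: measurable_cong_sets[OF sets_nat_measure refl])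
  ultimately show ?thesis
    using signed_distr_signed_density[of "whitening_map n" "nat_measure n \<theta>" borel "\<lambda>y. y $ i"]
    by (simp add: distr_whitening_map[OF assms])
qed

end

lemma ef_tangent_comb:
  assumes "\<theta> \<in> \<Theta>"
  shows "ef_tangent \<mu> T \<theta> (s *\<^sub>R a + t *\<^sub>R b) = tvec_comb s (ef_tangent \<mu> T \<theta> a) t (ef_tangent \<mu> T \<theta> b)"
  using signed_density_comb[OF integrable_score(1)[OF assms] integrable_score(1)[OF assms], of s a t b]
  by (simp add: ef_tangent_eq assms tvec_comb_def score_comb[abs_def])

lemma fst_tangent:
  "fst (ef_tangent \<mu> T \<theta> a) = P \<theta>"
  "fst (iid_tangent \<mu> T n \<theta> a) = iid_power n (P \<theta>)"
  "fst (nat_tangent \<mu> T n \<theta> a) = nat_measure n \<theta>"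
  by (simp_all add: ef_tangent_def iid_tangent_def nat_tangent_def nat_measure_def)

lemma ef_tangent_in_tangent_space:
  "\<theta> \<in> \<Theta> \<Longrightarrow> ef_tangent \<mu> T \<theta> a \<in> tangent_space \<Theta> (ef_tangent \<mu> T) (P \<theta>)"
  by (auto simp: tangent_space_def tangent_bundle_def fst_tangent)

end

section \<open>Characterisation of the Fisher metric\<close>

lemma bilinear_form_eq_multiple:
  fixes B V :: "'a::real_vector \<Rightarrow> 'a \<Rightarrow> real"
  assumes B: "\<And>s t a b c. B (s *\<^sub>R a + t *\<^sub>R b) c = s * B a c + t * B b c" "\<And>a b. B a b = B b a"
    and V: "\<And>s t a b c. V (s *\<^sub>R a + t *\<^sub>R b) c = s * V a c + t * V b c" "\<And>a b. V a b = V b a"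
    and V_pos: "\<And>a. a \<noteq> 0 \<Longrightarrow> V a a > 0"
    and unit: "\<And>a. V a a = 1 \<Longrightarrow> B a a = c"
  shows "B a b = c * V a b"
proof -
  have scale: "F (s *\<^sub>R a) (s *\<^sub>R a) = s\<^sup>2 * F a a"
    if F: "\<And>s t a b c. F (s *\<^sub>R a + t *\<^sub>R b) c = s * F a c + t * F b c" "\<And>a b. F a b = F b a"
    for F :: "'a \<Rightarrow> 'a \<Rightarrow> real" and s a
    using F(1)[of s a 0 0 "s *\<^sub>R a"] F(1)[of s a 0 0 a] F(2)[of a "s *\<^sub>R a"]
    by (simp add: power2_eq_square)
  have diag: "B a a = c * V a a" for a
  proof (cases "a = 0")
    case True
    then show ?thesis using scale[of B 0 a, OF B] scale[of V 0 a, OF V] by simp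
  next
    case False
    define r where "r = sqrt (V a a)"
    have r: "r > 0" "r\<^sup>2 = V a a" using V_pos[OF False] by (auto simp: r_def)
    have "V ((1 / r) *\<^sub>R a) ((1 / r) *\<^sub>R a) = 1"
      using r V_pos[OF False] by (subst scale[of V, OF V]) (simp_all add: power_divide)
    then have "B ((1 / r) *\<^sub>R a) ((1 / r) *\<^sub>R a) = c" by (rule unit)
    then have "(1 / r)\<^sup>2 * B a a = c" by (subst (asm) scale[of B, OF B])
    then show ?thesis using r V_pos[OF False] by (simp add: power_divide field_simps)
  qed
  have polar: "F (a + b) (a + b) = F a a + 2 * F a b + F b b"
    if F: "\<And>s t a b c. F (s *\<^sub>R a + t *\<^sub>R b) c = s * F a c + t * F b c" "\<And>a b. F a b = F b a"
    for F :: "'a \<Rightarrow> 'a \<Rightarrow> real" and a b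
    using F(1)[of 1 a 1 b "a + b"] F(1)[of 1 a 1 b a] F(1)[of 1 a 1 b b] F(2)[of a "a + b"] F(2)[of b "a + b"] F(2)[of b a]
    by simp
  show ?thesis
    using polar[of B a b, OF B] polar[of V a b, OF V] diag[of "a + b"] diag[of a] diag[of b]
    by (simp add: algebra_simps)
qed

theorem theorem1:
  fixes \<mu> :: "(real^'m) measure"
    and T :: "real^'m \<Rightarrow> real^'d"
    and g :: "(real^'m) tvec \<Rightarrow> (real^'m) tvec \<Rightarrow> real"
    and g_iid :: "nat \<Rightarrow> (nat \<Rightarrow> real^'m) tvec \<Rightarrow> (nat \<Rightarrow> real^'m) tvec \<Rightarrow> real"
    and g_nat :: "nat \<Rightarrow> (real^'d) tvec \<Rightarrow> (real^'d) tvec \<Rightarrow> real"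
  defines "\<Theta> \<equiv> param_space \<mu> T"
  assumes family: "regular_exponential_family \<mu> T"
    and metric: "riemannian_metric \<Theta> (ef_tangent \<mu> T) g"
    and metric_iid: "\<And>n. n \<ge> 1 \<Longrightarrow> riemannian_metric \<Theta> (iid_tangent \<mu> T n) (g_iid n)"
    and metric_nat: "\<And>n. n \<ge> 1 \<Longrightarrow> riemannian_metric \<Theta> (nat_tangent \<mu> T n) (g_nat n)"
    and A1: "\<And>n \<theta> a b. n \<ge> 1 \<Longrightarrow> \<theta> \<in> \<Theta> \<Longrightarrow>
        g_iid n (iid_tangent \<mu> T n \<theta> a) (iid_tangent \<mu> T n \<theta> b)
          = real n * g (ef_tangent \<mu> T \<theta> a) (ef_tangent \<mu> T \<theta> b)"
    and A2: "\<And>n \<theta> a b. n \<ge> 1 \<Longrightarrow> \<theta> \<in> \<Theta> \<Longrightarrow>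
        g_nat n (nat_tangent \<mu> T n \<theta> a) (nat_tangent \<mu> T n \<theta> b)
          = g_iid n (iid_tangent \<mu> T n \<theta> a) (iid_tangent \<mu> T n \<theta> b)"
    and A3: "\<exists>(\<T> :: (real^'d) tvec set) (H :: (real^'d) tvec \<Rightarrow> real).
        \<T> \<subseteq> {(P, A). borel_prob P \<and> signed_measure borel A} \<and>
        (\<forall>n\<ge>1. tangent_bundle \<Theta> (nat_tangent \<mu> T n) \<subseteq> \<T> \<and>
           (\<forall>v \<in> tangent_bundle \<Theta> (nat_tangent \<mu> T n). sqrt (g_nat n v v) = H v)) \<and>
        (\<forall>f :: real^'d \<Rightarrow> real. linear f \<longrightarrow>
           (std_normal_measure, signed_density std_normal_measure f) \<in> \<T>) \<and>
        (\<forall>(f :: real^'d \<Rightarrow> real) (P :: nat \<Rightarrow> (real^'d) measure).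
           linear f \<and>
           (\<forall>n\<ge>1. borel_prob (P n) \<and> has_mean_covariance (P n) 0 (mat 1)) \<and>
           (\<forall>n\<ge>1. (P n, signed_density (P n) f) \<in> \<T>) \<and>
           (\<exists>k. \<forall>n\<ge>1. H (P n, signed_density (P n) f) = k) \<and>
           converges_weakly P std_normal_measure \<longrightarrow>
           (\<forall>n\<ge>1. H (P n, signed_density (P n) f)
              = H (std_normal_measure, signed_density std_normal_measure f))) \<and>
        (\<forall>(P, A) \<in> \<T>. \<forall>(M :: real^'d^'d) (b :: real^'d). invertible M \<longrightarrow>
           (let L = (\<lambda>x. M *v x + b); Q = (distr P borel L, signed_distr P borel L A)
            in Q \<in> \<T> \<and> H Q = H (P, A)))"
  shows "\<exists>c>0. equals_multiple_of_fisher \<Theta> (ef_tangent \<mu> T) g c \<and>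
           (\<forall>n\<ge>1. equals_multiple_of_fisher \<Theta> (iid_tangent \<mu> T n) (g_iid n) c) \<and>
           (\<forall>n\<ge>1. equals_multiple_of_fisher \<Theta> (nat_tangent \<mu> T n) (g_nat n) c)"
proof -
  interpret regular_exponential_family \<mu> T by (rule family)
  obtain \<T> :: "(real^'d) tvec set" and H :: "(real^'d) tvec \<Rightarrow> real" where
    A3i: "\<forall>n\<ge>1. tangent_bundle \<Theta> (nat_tangent \<mu> T n) \<subseteq> \<T> \<and>
           (\<forall>v \<in> tangent_bundle \<Theta> (nat_tangent \<mu> T n). sqrt (g_nat n v v) = H v)"
    and A3iii: "\<forall>(f :: real^'d \<Rightarrow> real) (P :: nat \<Rightarrow> (real^'d) measure).
           linear f \<and>
           (\<forall>n\<ge>1. borel_prob (P n) \<and> has_mean_covariance (P n) 0 (mat 1)) \<and>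
           (\<forall>n\<ge>1. (P n, signed_density (P n) f) \<in> \<T>) \<and>
           (\<exists>k. \<forall>n\<ge>1. H (P n, signed_density (P n) f) = k) \<and>
           converges_weakly P std_normal_measure \<longrightarrow>
           (\<forall>n\<ge>1. H (P n, signed_density (P n) f)
              = H (std_normal_measure, signed_density std_normal_measure f))"
    and A3iv: "\<forall>(P, A) \<in> \<T>. \<forall>(M :: real^'d^'d) (b :: real^'d). invertible M \<longrightarrow>
           (let L = (\<lambda>x. M *v x + b); Q = (distr P borel L, signed_distr P borel L A)
            in Q \<in> \<T> \<and> H Q = H (P, A))"
    using A3 by (elim exE conjE) (rule that)
  have affine: "(distr P borel (\<lambda>x. M *v x + b), signed_distr P borel (\<lambda>x. M *v x + b) A) \<in> \<T> \<and>
      H (distr P borel (\<lambda>x. M *v x + b), signed_distr P borel (\<lambda>x. M *v x + b) A) = H (P, A)"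
    if "(P, A) \<in> \<T>" "invertible M" for P A M b
    using bspec[OF A3iv that(1)] that(2) by (simp add: Let_def)
  \<comment> \<open>The metric as a form on parameter directions at \<theta>, where
    \<open>ef_tangent_comb\<close> turns the operations of the tangent space into those of the
    vector space.\<close>
  define B where "B \<theta> a b = g (ef_tangent \<mu> T \<theta> a) (ef_tangent \<mu> T \<theta> b)" for \<theta> a b
  have inner: "inner_product_on (tangent_space \<Theta> (ef_tangent \<mu> T) (P \<theta>)) g" for \<theta>
    using metric by (simp add: riemannian_metric_def)
  note tangent = ef_tangent_in_tangent_space[folded \<Theta>_def]
  have B_sym: "B \<theta> a b = B \<theta> b a" if "\<theta> \<in> \<Theta>" for \<theta> a b
    using inner[of \<theta>] tangent[OF that] unfolding inner_product_on_def B_def by blast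
  have B_comb: "B \<theta> (s *\<^sub>R a + t *\<^sub>R b) c = s * B \<theta> a c + t * B \<theta> b c" if "\<theta> \<in> \<Theta>" for \<theta> s t a b c
    using inner[of \<theta>] tangent[OF that] ef_tangent_comb[of \<theta> s a t b] that
    unfolding inner_product_on_def B_def \<Theta>_def by simp
  have B_pos: "B \<theta> a a > 0" if "\<theta> \<in> \<Theta>" "a \<noteq> 0" for \<theta> a
    using inner[of \<theta>] tangent[OF that(1)] immersion[of \<theta> a] that
    unfolding inner_product_on_def B_def \<Theta>_def by blast
  \<comment> \<open>An arbitrary index, fixed ahead of \<theta> and \<open>a\<close>, so that
    \<open>f\<close> and the constant \<open>c\<close> built from it are common to all of
    them.\<close>
  define i0 :: 'd where "i0 = undefined"
  define f :: "real^'d \<Rightarrow> real" where "f = (\<lambda>y. y $ i0)"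
  have f: "linear f" unfolding f_def by (intro linearI) auto
  define c where "c = (H (std_normal_measure, signed_density std_normal_measure f))\<^sup>2"
  have unit: "B \<theta> a a = c" if \<theta>: "\<theta> \<in> \<Theta>" and a: "covariance \<theta> a a = 1" for \<theta> a
  proof -
    have \<theta>': "\<theta> \<in> param_space \<mu> T" using \<theta> by (simp add: \<Theta>_def)
    obtain w where w0: "w i0 = a"
      and w: "\<And>i j. covariance \<theta> (w i) (w j) = (if i = j then 1 else 0)"
      using covariance_orthonormal_basis[OF \<theta>' a, of i0] by metis
    interpret standardized_sample "P \<theta>" "whitened \<theta> w"
      by (rule standardized_sample_whitened[OF \<theta>' w])
    have "a \<noteq> 0" using a linear_0[OF covariance_linear[OF \<theta>', of 0]] by auto
    have law: "(law n, signed_density (law n) f) \<in> \<T> \<and> H (law n, signed_density (law n) f) = sqrt (B \<theta> a a)"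
      if n: "n \<ge> 1" for n
    proof -
      let ?a = "(1 / sqrt n) *\<^sub>R a"
      have in_bundle: "nat_tangent \<mu> T n \<theta> ?a \<in> tangent_bundle \<Theta> (nat_tangent \<mu> T n)"
        using \<theta> by (auto simp: tangent_bundle_def)
      have tangent_eq: "nat_tangent \<mu> T n \<theta> ?a = (nat_measure n \<theta>, signed_density (nat_measure n \<theta>) (nat_score n \<theta> ?a))"
        by (rule nat_tangent_eq[OF \<theta>' n])
      have L: "(\<lambda>x. whitening_matrix w n *v x + - (whitening_matrix w n *v mean \<theta>)) = whitening_map \<theta> w n"
        by (simp add: fun_eq_iff whitening_map_def[OF \<theta>' w])
      have "H (nat_tangent \<mu> T n \<theta> ?a) = sqrt (real n * B \<theta> ?a ?a)"
        using A3i[rule_format, OF n, THEN conjunct2, rule_format, OF in_bundle] A1[OF n \<theta>] A2[OF n \<theta>] by (simp add: B_def)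
      \<comment> \<open>Homogeneity gives 1 / n, which cancels the n from (A1) and (A2): the value
        of \<open>H\<close> is the same for all n.\<close>
      also have "B \<theta> ?a ?a = (1 / n) * B \<theta> a a"
        using B_comb[OF \<theta>, of "1 / sqrt n" a 0 0] B_sym[OF \<theta>, of a ?a] by simp
      finally have "H (nat_tangent \<mu> T n \<theta> ?a) = sqrt (B \<theta> a a)"
        using n by simp
      moreover have "distr (nat_measure n \<theta>) borel (whitening_map \<theta> w n) = law n"
        by (rule distr_whitening_map[OF \<theta>' w n])
      moreover have "signed_distr (nat_measure n \<theta>) borel (whitening_map \<theta> w n)
          (signed_density (nat_measure n \<theta>) (nat_score n \<theta> ?a)) = signed_density (law n) f"
        using signed_distr_whitening_map[OF \<theta>' w n, of i0] by (simp add: w0 f_def)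
      ultimately show ?thesis
        using affine[of "nat_measure n \<theta>" "signed_density (nat_measure n \<theta>) (nat_score n \<theta> ?a)"
            "whitening_matrix w n" "- (whitening_matrix w n *v mean \<theta>)"]
          invertible_whitening_matrix[OF \<theta>' w n] A3i[rule_format, OF n, THEN conjunct1] in_bundle
        unfolding L tangent_eq by auto
    qed
    have "\<forall>n\<ge>1. H (law n, signed_density (law n) f) = H (std_normal_measure, signed_density std_normal_measure f)"
      using f law borel_prob_law has_mean_covariance_law law_converges_weakly
      by (intro A3iii[THEN spec, of f, THEN spec, of law, THEN mp]) auto
    then have "sqrt (B \<theta> a a) = H (std_normal_measure, signed_density std_normal_measure f)"
      using law[of 1] by simp
    \<comment> \<open>Squaring undoes the root because \<open>B \<theta> a a\<close> is positive for
      the non-zero vector \<open>a\<close>.\<close>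
    then show "B \<theta> a a = c"
      using B_pos[OF \<theta> \<open>a \<noteq> 0\<close>] unfolding c_def by (metis less_imp_le real_sqrt_pow2)
  qed
  have B_eq: "B \<theta> a b = c * covariance \<theta> a b" if "\<theta> \<in> \<Theta>" for \<theta> a b
    using that B_comb B_sym unit covariance_sym covariance_comb_left covariance_pos unfolding \<Theta>_def
    by (intro bilinear_form_eq_multiple[of "B \<theta>" "covariance \<theta>"]) auto
  have "c > 0"
  proof -
    obtain \<theta> where \<theta>: "\<theta> \<in> \<Theta>" using param_space_nonempty by (auto simp: \<Theta>_def)
    have a: "axis i0 1 \<noteq> (0 :: real^'d)"
      by (metis axis_eq_0_iff zero_neq_one)
    show ?thesis
      using B_pos[OF \<theta> a] B_eq[OF \<theta>, of "axis i0 1" "axis i0 1"] covariance_pos[of \<theta>, OF _ a] \<theta>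
      by (simp add: \<Theta>_def zero_less_mult_iff)
  qed
  moreover have "equals_multiple_of_fisher \<Theta> (ef_tangent \<mu> T) g c"
  proof (rule equals_multiple_of_fisherI[where B = P])
    show "inj_on P \<Theta>" using inj_param by (simp add: \<Theta>_def)
  qed (use B_eq in \<open>auto simp: B_def \<Theta>_def fisher_metric_ef fst_tangent\<close>)
  \<comment> \<open>Both \<open>g_iid n\<close> and the Fisher metric are n times their counterparts
    on the original family, so the same constant persists; likewise for the natural family.\<close>
  moreover have "equals_multiple_of_fisher \<Theta> (iid_tangent \<mu> T n) (g_iid n) c" if n: "n \<ge> 1" for n
  proof (rule equals_multiple_of_fisherI[where B = "\<lambda>\<theta>. iid_power n (P \<theta>)"])
    show "inj_on (\<lambda>\<theta>. iid_power n (P \<theta>)) \<Theta>" using iid_power_P_inj[OF n] by (simp add: \<Theta>_def)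
  qed (use B_eq A1[OF n] in \<open>auto simp: B_def \<Theta>_def fisher_metric_iid fst_tangent\<close>)
  moreover have "equals_multiple_of_fisher \<Theta> (nat_tangent \<mu> T n) (g_nat n) c" if n: "n \<ge> 1" for n
  proof (rule equals_multiple_of_fisherI[where B = "nat_measure n"])
    show "inj_on (nat_measure n) \<Theta>" using nat_measure_inj[OF n] by (simp add: \<Theta>_def)
  qed (use B_eq A1[OF n] A2[OF n] n in \<open>auto simp: B_def \<Theta>_def fisher_metric_nat fst_tangent\<close>)
  ultimately show ?thesis by blast
qed

end
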